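(* Let $\eta=\{\eta(t);t\in[0,1]\}$ be a mean zero continuous Gaussian process with covariance $U=\{U(s,t);s,t\in[0,1]\}$. For each integer $k\ge 1$ let $\eta_1,\ldots,\eta_k$ be independent copies of $\eta$ and set $Y_k(t)=\sum_{i=1}^k\eta_i^2(t)$, $t\in[0,1]$. Set $$\sigma^2(u,v)=E(\eta(u)-\eta(v))^2,\qquad \widetilde\sigma^2(x)=\sup_{u,v\in[0,1],\,|u-v|\le x}\sigma^2(u,v).$$ Assume that $\inf_{t\in[0,1]}U(t,t)>0$ and $$\lim_{x\to 0}\widetilde\sigma^2(x)\log(1/x)=0.$$ Let $\varphi$ be a positive function on $[0,1]$. If for all intervals $\Delta\subset[0,1]$ of positive length $$\lim_{h\to 0}\ \sup_{\substack{|u-v|\le h\\ u,v\in\Delta}}\frac{\eta(u)-\eta(v)}{\varphi(|u-v|)}=1\qquad\text{a.s.},$$ then for all intervals $\Delta\subset[0,1]$ of positive length and all integers $k\ge 1$, $$\lim_{h\to 0}\ \sup_{\substack{|u-v|\le h\\ u,v\in\Delta}}\frac{Y_k(u)-Y_k(v)}{\varphi(|u-v|)}=2\sup_{u\in\Delta}Y_k^{1/2}(u)\qquad\text{a.s.}$$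
   Context: The process $Y_k=\{Y_k(t),t\in[0,1]\}$ is called a chi-square process of order $k$ with kernel $U$. Here $U(s,t)=E(\eta(s)\eta(t))$, $Y_k^{1/2}(u)=(Y_k(u))^{1/2}$, and limits as $h\to0$ and $x\to0$ are taken through positive values. *)

theory Defs
  imports "HOL-Probability.Probability"
begin

(* A Gaussian law may be degenerate (standard deviation s = 0). *)
definition gaussian_rv :: "'a measure \<Rightarrow> ('a \<Rightarrow> real) \<Rightarrow> bool" where
  "gaussian_rv M Z \<longleftrightarrow> Z \<in> borel_measurable M \<and>
     (\<exists>m s. s \<ge> 0 \<and>
        distr M borel Z = (if s = 0 then return borel m else density lborel (normal_density m s)))"

definition gaussian_process :: "'a measure \<Rightarrow> (real \<Rightarrow> 'a \<Rightarrow> real) \<Rightarrow> bool" where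
  "gaussian_process M \<eta> \<longleftrightarrow> prob_space M \<and>
     (\<forall>t\<in>{0..1}. \<eta> t \<in> borel_measurable M) \<and>
     (\<forall>F c. finite F \<and> F \<subseteq> {0..1} \<longrightarrow> gaussian_rv M (\<lambda>\<omega>. \<Sum>t\<in>F. c t * \<eta> t \<omega>))"

definition mean_zero :: "'a measure \<Rightarrow> (real \<Rightarrow> 'a \<Rightarrow> real) \<Rightarrow> bool" where
  "mean_zero M \<eta> \<longleftrightarrow> (\<forall>t\<in>{0..1}. prob_space.expectation M (\<eta> t) = 0)"

definition continuous_process :: "'a measure \<Rightarrow> (real \<Rightarrow> 'a \<Rightarrow> real) \<Rightarrow> bool" where
  "continuous_process M \<eta> \<longleftrightarrow> (AE \<omega> in M. continuous_on {0..1} (\<lambda>t. \<eta> t \<omega>))"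

(* E (eta s * eta t); this is the covariance when eta has mean zero. *)
definition covar :: "'a measure \<Rightarrow> (real \<Rightarrow> 'a \<Rightarrow> real) \<Rightarrow> real \<Rightarrow> real \<Rightarrow> real" where
  "covar M \<eta> s t = prob_space.expectation M (\<lambda>\<omega>. \<eta> s \<omega> * \<eta> t \<omega>)"

definition sigma2 :: "'a measure \<Rightarrow> (real \<Rightarrow> 'a \<Rightarrow> real) \<Rightarrow> real \<Rightarrow> real \<Rightarrow> real" where
  "sigma2 M \<eta> u v = prob_space.expectation M (\<lambda>\<omega>. (\<eta> u \<omega> - \<eta> v \<omega>)\<^sup>2)"

(* Suprema are taken in ereal, so that no boundedness is presupposed. *)
definition sigma2_sup :: "'a measure \<Rightarrow> (real \<Rightarrow> 'a \<Rightarrow> real) \<Rightarrow> real \<Rightarrow> ereal" where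
  "sigma2_sup M \<eta> x =
     (SUP (u, v)\<in>{(u, v). u \<in> {0..1} \<and> v \<in> {0..1} \<and> \<bar>u - v\<bar> \<le> x}. ereal (sigma2 M \<eta> u v))"

(* The whole path as a random element of the product space over [0,1]. *)
definition sample_path :: "(real \<Rightarrow> 'a \<Rightarrow> real) \<Rightarrow> 'a \<Rightarrow> real \<Rightarrow> real" where
  "sample_path \<eta> \<omega> = (\<lambda>t\<in>{0..1}. \<eta> t \<omega>)"

abbreviation path_space :: "(real \<Rightarrow> real) measure" where
  "path_space \<equiv> Pi\<^sub>M {0..1} (\<lambda>_. borel)"

(* X 1, ..., X k are independent copies of the continuous process eta. They may live on a
   different probability space N. The product sigma-algebra does not see continuity of paths,
   so equality of laws alone would not make a copy continuous; it is required separately. *)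
definition independent_copies ::
  "'b measure \<Rightarrow> nat \<Rightarrow> (nat \<Rightarrow> real \<Rightarrow> 'b \<Rightarrow> real) \<Rightarrow> 'a measure \<Rightarrow> (real \<Rightarrow> 'a \<Rightarrow> real) \<Rightarrow> bool" where
  "independent_copies N k X M \<eta> \<longleftrightarrow> prob_space N \<and>
     (\<forall>i\<in>{1..k}. (\<forall>t\<in>{0..1}. X i t \<in> borel_measurable N) \<and>
        distr N path_space (sample_path (X i)) = distr M path_space (sample_path \<eta>) \<and>
        continuous_process N (X i)) \<and>
     prob_space.indep_vars N (\<lambda>_. path_space) (\<lambda>i. sample_path (X i)) {1..k}"

definition chi_square :: "nat \<Rightarrow> (nat \<Rightarrow> real \<Rightarrow> 'b \<Rightarrow> real) \<Rightarrow> real \<Rightarrow> 'b \<Rightarrow> real" where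
  "chi_square k X t \<omega> = (\<Sum>i=1..k. (X i t \<omega>)\<^sup>2)"

(* Open, half-open and closed intervals are all allowed. *)
definition nondegenerate_subinterval :: "real set \<Rightarrow> bool" where
  "nondegenerate_subinterval \<Delta> \<longleftrightarrow> is_interval \<Delta> \<and> \<Delta> \<subseteq> {0..1} \<and> 0 < measure lborel \<Delta>"

definition increment_sup :: "(real \<Rightarrow> real) \<Rightarrow> real set \<Rightarrow> (real \<Rightarrow> real) \<Rightarrow> real \<Rightarrow> ereal" where
  "increment_sup \<phi> \<Delta> f h =
     (SUP (u, v)\<in>{(u, v). u \<in> \<Delta> \<and> v \<in> \<Delta> \<and> \<bar>u - v\<bar> \<le> h}. ereal ((f u - f v) / \<phi> \<bar>u - v\<bar>))"

end

theory Submission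
  imports Defs
begin

text \<open>
View the copies as one vector-valued process \<open>X = (X 1, \<dots>, X k)\<close>, so that the chi-square process is its
squared Euclidean length. For a fixed unit vector \<open>a\<close> the scalar process \<open>a \<bullet> X\<close> has the same law as \<open>\<eta>\<close>
(\<open>law_of_unit_combination_of_copies\<close>), hence the same modulus of continuity \<open>\<phi>\<close> almost surely
(\<open>AE_increment_sup_tendsto_transfer\<close>). Almost surely this holds simultaneously for a countable dense set
of directions \<open>a\<close>, and on \<open>\<Delta>\<close> as well as on all its subintervals with rational endpoints. The rest is a
statement about a single continuous path (\<open>squared_norm_increment_sup_tendsto\<close>).

Pathwise, the increment of the squared length is the inner product of \<open>X u - X v\<close> and \<open>X u + X v\<close>. Since
length is the maximum over unit directions, the modulus of the directions gives
\<open>norm (X u - X v) \<le> (1 + o(1)) * \<phi> \<bar>u - v\<bar>\<close>, and \<open>norm (X u + X v)\<close> is at most twice the supremum of the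
length: this is the upper bound. For the lower bound take \<open>u0\<close> where the length is almost maximal and
let \<open>a\<close> be close to the direction of \<open>X u0\<close>. In a short interval beside \<open>u0\<close>, \<open>X u + X v\<close> is close to
\<open>2 * X u0\<close>, and there are arbitrarily close \<open>u\<close>, \<open>v\<close> whose increment in direction \<open>a\<close> is almost
\<open>\<phi> \<bar>u - v\<bar>\<close>.

Two points need care on the probabilistic side. Nothing is known about \<open>\<phi>\<close> but positivity, so a countable
set of pairs adapted to \<open>\<phi>\<close> is needed to make the modulus a measurable property of the path
(\<open>countable_subset_same_weighted_increment_SUP\<close>). And equality of the laws of the paths is deduced from
characteristic functions of linear combinations by a Cramer-Wold argument
(\<open>joint_law_unique_of_linear_combinations\<close>).
\<close>

section \<open>Increment suprema\<close>

lemma increment_sup_mono: "mono (increment_sup \<phi> \<Delta> f)"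
  unfolding increment_sup_def by (intro monoI SUP_subset_mono) auto

lemma increment_le_increment_sup:
  assumes "u \<in> \<Delta>" "v \<in> \<Delta>" "\<bar>u - v\<bar> \<le> h"
  shows "ereal ((f u - f v) / \<phi> \<bar>u - v\<bar>) \<le> increment_sup \<phi> \<Delta> f h"
proof -
  have "(case (u, v) of (u, v) \<Rightarrow> ereal ((f u - f v) / \<phi> \<bar>u - v\<bar>)) \<le> increment_sup \<phi> \<Delta> f h"
    unfolding increment_sup_def by (rule SUP_upper) (use assms in auto)
  then show ?thesis by simp
qed

lemma mono_tendsto_at_right_0_iff:
  fixes g :: "real \<Rightarrow> 'b :: linorder_topology"
  assumes "mono g"
  shows "(g \<longlongrightarrow> l) (at_right 0) \<longleftrightarrow> (\<lambda>n. g (inverse (real (Suc n)))) \<longlonglongrightarrow> l"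
proof
  assume "(g \<longlongrightarrow> l) (at_right 0)"
  moreover have "filterlim (\<lambda>n. inverse (real (Suc n))) (at_right 0) sequentially"
    unfolding filterlim_at using LIMSEQ_inverse_real_of_nat by (auto intro!: always_eventually)
  ultimately show "(\<lambda>n. g (inverse (real (Suc n)))) \<longlonglongrightarrow> l"
    by (rule filterlim_compose)
next
  assume L: "(\<lambda>n. g (inverse (real (Suc n)))) \<longlonglongrightarrow> l"
  show "(g \<longlongrightarrow> l) (at_right 0)"
  proof (rule order_tendstoI)
    fix y assume "y < l"
    then obtain m where m: "\<And>n. n \<ge> m \<Longrightarrow> y < g (inverse (real (Suc n)))"
      using order_tendstoD(1)[OF L] unfolding eventually_sequentially by blast
    have "y < g h" if h: "h > 0" for h
    proof -
      obtain n where "inverse (real (Suc n)) < h"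
        using reals_Archimedean[OF h] by auto
      moreover have "inverse (real (Suc (max n m))) \<le> inverse (real (Suc n))"
        by (rule le_imp_inverse_le) auto
      ultimately have "inverse (real (Suc (max n m))) \<le> h" by (meson less_imp_le order_trans)
      then show ?thesis
        using m[of "max n m"] monoD[OF assms] by (meson less_le_trans max.cobounded2)
    qed
    then show "\<forall>\<^sub>F h in at_right 0. y < g h"
      by (simp add: eventually_at_filter)
  next
    fix y assume "l < y"
    then obtain m where m: "g (inverse (real (Suc m))) < y"
      using order_tendstoD(2)[OF L] unfolding eventually_sequentially by blast
    show "\<forall>\<^sub>F h in at_right 0. g h < y"
      unfolding eventually_at_right_field
    proof (intro exI[of _ "inverse (real (Suc m))"] conjI allI impI)
      fix h assume "h < inverse (real (Suc m))"
      then have "g h \<le> g (inverse (real (Suc m)))" using monoD[OF assms] by simp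
      then show "g h < y" using m by simp
    qed simp
  qed
qed

text \<open>The weight \<open>\<psi>\<close> is arbitrary, so a dense set of pairs would not do: the increment at \<open>(u, v)\<close> must
be approximated at pairs whose weight is close to \<open>\<psi> u v\<close> as well. Taking \<open>T\<close> below a countable dense
subset of the graph of \<open>1 / \<psi>\<close> achieves this, for all continuous \<open>f\<close> at once.\<close>

lemma countable_subset_same_weighted_increment_SUP:
  fixes A :: "(real \<times> real) set" and \<psi> :: "real \<Rightarrow> real \<Rightarrow> real"
  assumes A: "A \<subseteq> S \<times> S"
  shows "\<exists>T. countable T \<and> T \<subseteq> A \<and> (\<forall>f. continuous_on S f \<longrightarrow>
    (SUP (u, v)\<in>T. ereal ((f u - f v) / \<psi> u v)) = (SUP (u, v)\<in>A. ereal ((f u - f v) / \<psi> u v)))"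
proof -
  define G where "G = (\<lambda>p. (p, inverse (\<psi> (fst p) (snd p))))"
  obtain R where R: "countable R" "R \<subseteq> G ` A" "G ` A \<subseteq> closure R"
    using separable[of "G ` A"] by metis
  define T where "T = fst ` R"
  have R_G: "x = G (fst x)" if "x \<in> R" for x
    using that R(2) by (auto simp: G_def)
  have T: "countable T" "T \<subseteq> A" "R \<subseteq> G ` T"
  proof -
    show "countable T" using R(1) by (simp add: T_def)
    show "T \<subseteq> A" using R(2) by (auto simp: T_def G_def)
    show "R \<subseteq> G ` T" using R_G by (auto simp only: T_def image_image intro: image_eqI)
  qed
  have "(SUP (u, v)\<in>A. ereal ((f u - f v) / \<psi> u v)) \<le> (SUP (u, v)\<in>T. ereal ((f u - f v) / \<psi> u v))"
    if f: "continuous_on S f" for f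
  proof (rule SUP_least, clarify)
    fix u v assume uv: "(u, v) \<in> A"
    then have "G (u, v) \<in> closure R" using R by auto
    then obtain x where x: "\<And>n. x n \<in> R" "x \<longlonglongrightarrow> G (u, v)"
      unfolding closure_sequential by auto
    define U where "U n = fst (fst (x n))" for n
    define V where "V n = snd (fst (x n))" for n
    have T_n: "(U n, V n) \<in> T" for n
      using x(1)[of n] by (simp add: T_def U_def V_def)
    have snd_x: "snd (x n) = inverse (\<psi> (U n) (V n))" for n
    proof -
      have "x n \<in> G ` T" using x(1) T(3) by auto
      then show ?thesis by (auto simp: G_def U_def V_def)
    qed
    have lims: "U \<longlonglongrightarrow> u" "V \<longlonglongrightarrow> v" "(\<lambda>n. inverse (\<psi> (U n) (V n))) \<longlonglongrightarrow> inverse (\<psi> u v)"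
    proof -
      have "(\<lambda>n. fst (fst (x n))) \<longlonglongrightarrow> fst (fst (G (u, v)))"
        "(\<lambda>n. snd (fst (x n))) \<longlonglongrightarrow> snd (fst (G (u, v)))"
        "(\<lambda>n. snd (x n)) \<longlonglongrightarrow> snd (G (u, v))"
        by (intro tendsto_fst tendsto_snd x)+
      then show "U \<longlonglongrightarrow> u" "V \<longlonglongrightarrow> v" "(\<lambda>n. inverse (\<psi> (U n) (V n))) \<longlonglongrightarrow> inverse (\<psi> u v)"
        unfolding U_def[symmetric] V_def[symmetric] snd_x by (simp_all add: G_def)
    qed
    have UV: "U n \<in> S" "V n \<in> S" for n using T_n[of n] T(2) A by auto
    have uvS: "u \<in> S" "v \<in> S" using uv A by auto
    have "(\<lambda>n. f (U n)) \<longlonglongrightarrow> f u" "(\<lambda>n. f (V n)) \<longlonglongrightarrow> f v"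
      using f uvS UV lims by (auto intro!: continuous_on_tendsto_compose[OF f])
    then have "(\<lambda>n. (f (U n) - f (V n)) * inverse (\<psi> (U n) (V n))) \<longlonglongrightarrow> (f u - f v) * inverse (\<psi> u v)"
      by (intro tendsto_intros lims)
    then have "(\<lambda>n. ereal ((f (U n) - f (V n)) / \<psi> (U n) (V n))) \<longlonglongrightarrow> ereal ((f u - f v) / \<psi> u v)"
      by (simp add: divide_inverse)
    moreover have "ereal ((f (U n) - f (V n)) / \<psi> (U n) (V n)) \<le> (SUP (u, v)\<in>T. ereal ((f u - f v) / \<psi> u v))" for n
      using SUP_upper[OF T_n[of n], of "\<lambda>(u, v). ereal ((f u - f v) / \<psi> u v)"] by simp
    ultimately show "ereal ((f u - f v) / \<psi> u v) \<le> (SUP (u, v)\<in>T. ereal ((f u - f v) / \<psi> u v))"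
      by (meson LIMSEQ_le_const2)
  qed
  moreover have "(SUP (u, v)\<in>T. ereal ((f u - f v) / \<psi> u v)) \<le> (SUP (u, v)\<in>A. ereal ((f u - f v) / \<psi> u v))" for f
    by (rule SUP_subset_mono) (use T in auto)
  ultimately show ?thesis using T by (intro exI[of _ T] conjI allI impI order_antisym) auto
qed

section \<open>Finite nets of directions\<close>

text \<open>Cut the cube into cells of side \<open>1 / n\<close>. Only finitely many cells meet the unit sphere, and choosing
one unit vector from each of these keeps the net on the sphere itself.\<close>

lemma sphere_finite_net:
  fixes I :: "'i set"
  assumes I: "finite I" and e: "\<epsilon> > 0"
  shows "\<exists>A. finite A \<and> (\<forall>a\<in>A. L2_set a I = 1) \<and>
    (\<forall>c. L2_set c I = 1 \<longrightarrow> (\<exists>a\<in>A. L2_set (\<lambda>i. c i - a i) I \<le> \<epsilon>))"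
proof -
  define S where "S = {c :: 'i \<Rightarrow> real. L2_set c I = 1}"
  obtain n :: nat where n: "real (card I) / \<epsilon> < real n"
    using reals_Archimedean2 by blast
  moreover have "0 \<le> real (card I) / \<epsilon>" using e by simp
  ultimately have n_pos: "n > 0" using of_nat_0_less_iff[where ?'a = real, of n] by linarith
  define g where "g c = (\<lambda>i\<in>I. \<lfloor>real n * c i\<rfloor>)" for c :: "'i \<Rightarrow> real"
  have "g ` S \<subseteq> (\<Pi>\<^sub>E i\<in>I. {- int n..int n})"
  proof (clarsimp simp: g_def, intro conjI)
    fix c i assume "c \<in> S" "i \<in> I"
    then have "\<bar>c i\<bar> \<le> 1"
      using member_le_L2_set[OF I \<open>i \<in> I\<close>, of "\<lambda>i. \<bar>c i\<bar>"] by (simp add: S_def L2_set_def)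
    then have "real n * c i \<le> real n * 1" "real n * (-1) \<le> real n * c i"
      by (intro mult_left_mono; simp)+
    then show "- int n \<le> \<lfloor>real n * c i\<rfloor>" "\<lfloor>real n * c i\<rfloor> \<le> int n"
      by (auto simp: le_floor_iff floor_le_iff)
  qed
  then have "finite (g ` S)"
    by (rule finite_subset) (auto intro!: finite_PiE I)
  then obtain A where A: "A \<subseteq> S" "finite A" "g ` S = g ` A"
    using finite_subset_image[of "g ` S" g S] by auto
  have "\<exists>a\<in>A. L2_set (\<lambda>i. c i - a i) I \<le> \<epsilon>" if "c \<in> S" for c
  proof -
    have "g c \<in> g ` A" using A(3) that by blast
    then obtain a where a: "a \<in> A" "g a = g c" by auto
    have "\<bar>c i - a i\<bar> \<le> 1 / real n" if "i \<in> I" for i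
    proof -
      have "\<lfloor>real n * a i\<rfloor> = \<lfloor>real n * c i\<rfloor>"
        using fun_cong[OF a(2), of i] that by (simp add: g_def)
      then have "\<bar>real n * (c i - a i)\<bar> \<le> 1"
        unfolding right_diff_distrib by linarith
      then have "real n * \<bar>c i - a i\<bar> \<le> 1" by (simp only: abs_mult abs_of_nat)
      then show ?thesis using n_pos by (simp add: pos_le_divide_eq mult.commute)
    qed
    then have "(\<Sum>i\<in>I. \<bar>c i - a i\<bar>) \<le> real (card I) * (1 / real n)"
      by (rule sum_bounded_above)
    also have "\<dots> \<le> \<epsilon>" using n n_pos e by (simp add: field_simps)
    finally show ?thesis
      using L2_set_le_sum_abs[of "\<lambda>i. c i - a i" I] a by force
  qed
  then show ?thesis using A unfolding S_def by (intro exI[of _ A]) auto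
qed

text \<open>An \<open>\<epsilon>\<close>-net of the unit sphere, stated homogeneously so that it applies to increments without
normalising them.\<close>

definition direction_net :: "'i set \<Rightarrow> real \<Rightarrow> ('i \<Rightarrow> real) set \<Rightarrow> bool" where
  "direction_net I \<epsilon> A \<longleftrightarrow> (\<forall>w. L2_set w I > 0 \<longrightarrow>
     (\<exists>a\<in>A. L2_set (\<lambda>i. w i - L2_set w I * a i) I \<le> \<epsilon> * L2_set w I))"

lemma countable_directions:
  fixes I :: "'i set"
  assumes I: "finite I"
  obtains D where "countable D" "\<And>a. a \<in> D \<Longrightarrow> L2_set a I = 1"
    and "\<And>\<epsilon>. \<epsilon> > 0 \<Longrightarrow> \<exists>A\<subseteq>D. finite A \<and> direction_net I \<epsilon> A"
proof -
  obtain A where A: "\<And>n::nat. finite (A n)" "\<And>n a. a \<in> A n \<Longrightarrow> L2_set a I = 1"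
    "\<And>n c. L2_set c I = 1 \<Longrightarrow> \<exists>a\<in>A n. L2_set (\<lambda>i. c i - a i) I \<le> inverse (Suc n)"
    using sphere_finite_net[OF I, of "inverse (Suc n)" for n] 
    by (simp add: choice_iff) metis
  show ?thesis
  proof (rule that[of "\<Union>n. A n"])
    show "countable (\<Union>n. A n)" using A by (auto intro: countable_finite)
    fix \<epsilon> :: real assume "\<epsilon> > 0"
    then obtain n where n: "inverse (real (Suc n)) < \<epsilon>" using reals_Archimedean by auto
    have "\<exists>a\<in>A n. L2_set (\<lambda>i. w i - L2_set w I * a i) I \<le> \<epsilon> * L2_set w I" if w: "L2_set w I > 0" for w
    proof -
      let ?r = "L2_set w I"
      have "L2_set (\<lambda>i. inverse ?r * w i) I = inverse ?r * ?r"
        using w by (subst L2_set_right_distrib) auto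
      then obtain a where a: "a \<in> A n" "L2_set (\<lambda>i. inverse ?r * w i - a i) I \<le> inverse (Suc n)"
        using A(3)[of "\<lambda>i. inverse ?r * w i" n] w by auto
      have "L2_set (\<lambda>i. w i - ?r * a i) I = L2_set (\<lambda>i. ?r * (inverse ?r * w i - a i)) I"
        using w by (intro L2_set_cong) (auto simp: right_diff_distrib mult.assoc[symmetric])
      also have "\<dots> = ?r * L2_set (\<lambda>i. inverse ?r * w i - a i) I"
        by (rule L2_set_right_distrib[symmetric]) (simp add: L2_set_nonneg)
      also have "\<dots> \<le> ?r * \<epsilon>" using a n w by (intro mult_left_mono) auto
      finally show ?thesis using a by (auto simp: mult.commute)
    qed
    then show "\<exists>B\<subseteq>(\<Union>n. A n). finite B \<and> direction_net I \<epsilon> B"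
      unfolding direction_net_def using A(1) by (intro exI[of _ "A n"]) auto
  qed (use A in auto)
qed

section \<open>The modulus of the squared norm of a path\<close>

text \<open>The length of \<open>w\<close> is the largest of its components in unit directions, and restricting to the
directions of a net costs only the factor \<open>1 - \<epsilon>\<close>.\<close>

lemma norm_le_of_directional_bounds:
  assumes net: "direction_net I \<epsilon> A"
    and m: "\<And>a. a \<in> A \<Longrightarrow> (\<Sum>i\<in>I. a i * w i) \<le> m" and w: "L2_set w I > 0"
  shows "(1 - \<epsilon>) * L2_set w I \<le> m"
proof -
  let ?r = "L2_set w I"
  obtain a where a: "a \<in> A" "L2_set (\<lambda>i. w i - ?r * a i) I \<le> \<epsilon> * ?r" using net w unfolding direction_net_def by auto
  have "?r * ?r = (\<Sum>i\<in>I. w i * w i)"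
    by (simp add: L2_set_def sum_nonneg power2_eq_square)
  also have "\<dots> = ?r * (\<Sum>i\<in>I. a i * w i) + (\<Sum>i\<in>I. (w i - ?r * a i) * w i)"
    by (simp add: sum_distrib_left sum.distrib[symmetric] algebra_simps)
  also have "(\<Sum>i\<in>I. (w i - ?r * a i) * w i) \<le> L2_set (\<lambda>i. w i - ?r * a i) I * ?r"
    by (rule order_trans[OF sum_mono L2_set_mult_ineq]) (simp add: abs_mult[symmetric])
  also have "\<dots> \<le> (\<epsilon> * ?r) * ?r"
    using a w by (intro mult_right_mono) auto
  also have "?r * (\<Sum>i\<in>I. a i * w i) \<le> ?r * m"
    using m[OF a(1)] w by (intro mult_left_mono) auto
  finally have "?r * ((1 - \<epsilon>) * ?r) \<le> ?r * m" by (simp add: algebra_simps)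
  then show ?thesis using w by simp
qed

text \<open>Only finitely many directions matter, so there is one \<open>h\<close> that serves all of them; this is what
turns the moduli of the directional processes into one for the length of the vector increment. The
constant comes from \<open>(1 + \<epsilon>) / (1 - \<epsilon>) \<le> 1 + 4 * \<epsilon>\<close>.\<close>

lemma norm_increment_eventually_le:
  fixes f :: "'i \<Rightarrow> real \<Rightarrow> real"
  assumes A: "finite A"
    and net: "direction_net I \<epsilon> A"
    and eps: "0 < \<epsilon>" "\<epsilon> \<le> 1/2"
    and pos: "\<And>x. x \<in> {0..1} \<Longrightarrow> \<phi> x > 0" and \<Delta>: "\<Delta> \<subseteq> {0..1}"
    and conv: "\<And>a. a \<in> A \<Longrightarrow> (increment_sup \<phi> \<Delta> (\<lambda>t. \<Sum>i\<in>I. a i * f i t) \<longlongrightarrow> 1) (at_right 0)"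
  shows "\<forall>\<^sub>F h in at_right 0. \<forall>u\<in>\<Delta>. \<forall>v\<in>\<Delta>. \<bar>u - v\<bar> \<le> h \<longrightarrow>
    L2_set (\<lambda>i. f i u - f i v) I \<le> (1 + 4 * \<epsilon>) * \<phi> \<bar>u - v\<bar>"
proof -
  have "\<forall>\<^sub>F h in at_right 0. \<forall>a\<in>A. increment_sup \<phi> \<Delta> (\<lambda>t. \<Sum>i\<in>I. a i * f i t) h < ereal (1 + \<epsilon>)"
    using A eps by (intro eventually_ball_finite ballI order_tendstoD(2)[OF conv]) auto
  then show ?thesis
  proof (rule eventually_mono, intro ballI impI)
    fix h u v
    assume h: "\<forall>a\<in>A. increment_sup \<phi> \<Delta> (\<lambda>t. \<Sum>i\<in>I. a i * f i t) h < ereal (1 + \<epsilon>)"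
      and uv: "u \<in> \<Delta>" "v \<in> \<Delta>" "\<bar>u - v\<bar> \<le> h"
    define w where "w i = f i u - f i v" for i
    have "\<bar>u - v\<bar> \<in> {0..1}" using subsetD[OF \<Delta> uv(1)] subsetD[OF \<Delta> uv(2)] by auto
    then have \<phi>: "\<phi> \<bar>u - v\<bar> > 0" by (rule pos)
    have dir: "(\<Sum>i\<in>I. a i * w i) \<le> (1 + \<epsilon>) * \<phi> \<bar>u - v\<bar>" if "a \<in> A" for a
    proof -
      have "ereal (((\<Sum>i\<in>I. a i * f i u) - (\<Sum>i\<in>I. a i * f i v)) / \<phi> \<bar>u - v\<bar>) < ereal (1 + \<epsilon>)"
        using increment_le_increment_sup[OF uv] h that by (meson le_less_trans)
      then show ?thesis
        using \<phi> by (simp add: w_def right_diff_distrib sum_subtractf pos_divide_less_eq)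
    qed
    have "L2_set w I \<le> (1 + 4 * \<epsilon>) * \<phi> \<bar>u - v\<bar>"
    proof (cases "L2_set w I > 0")
      case True
      have "(1 - \<epsilon>) * L2_set w I \<le> (1 + \<epsilon>) * \<phi> \<bar>u - v\<bar>"
        by (rule norm_le_of_directional_bounds[OF net dir True])
      also have "\<dots> \<le> ((1 - \<epsilon>) * (1 + 4 * \<epsilon>)) * \<phi> \<bar>u - v\<bar>"
      proof (rule mult_right_mono)
        have "\<epsilon> * (2 - 4 * \<epsilon>) \<ge> 0" using eps by (intro mult_nonneg_nonneg) auto
        then show "1 + \<epsilon> \<le> (1 - \<epsilon>) * (1 + 4 * \<epsilon>)" by (simp add: algebra_simps)
      qed (use \<phi> in simp)
      finally have "(1 - \<epsilon>) * L2_set w I \<le> (1 - \<epsilon>) * ((1 + 4 * \<epsilon>) * \<phi> \<bar>u - v\<bar>)"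
        by (simp only: mult.assoc)
      then show ?thesis using eps by (simp only: mult_le_cancel_left_pos)
    next
      case False
      then show ?thesis using \<phi> eps by (smt (verit) mult_nonneg_nonneg)
    qed
    then show "L2_set (\<lambda>i. f i u - f i v) I \<le> (1 + 4 * \<epsilon>) * \<phi> \<bar>u - v\<bar>"
      by (simp add: w_def[abs_def])
  qed
qed

lemma nondegenerate_subinterval_has_other_point:
  assumes "nondegenerate_subinterval \<Delta>"
  obtains z where "z \<in> \<Delta>" "z \<noteq> u"
proof (rule ccontr)
  assume "\<not> thesis"
  then have "\<Delta> \<subseteq> {u}" using that by auto
  then have "\<Delta> = {} \<or> \<Delta> = {u}" by auto
  then show False using assms unfolding nondegenerate_subinterval_def by auto
qed

text \<open>The subinterval lies beside \<open>u\<close> and may miss it, which keeps it inside \<open>\<Delta>\<close> also when \<open>u\<close> is an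
endpoint. Rational endpoints leave only countably many subintervals to control.\<close>

lemma rational_subinterval_near:
  assumes \<Delta>: "nondegenerate_subinterval \<Delta>" and u: "u \<in> \<Delta>" and d: "\<delta> > 0"
  obtains p q where "p \<in> \<rat>" "q \<in> \<rat>" "p < q" "{p..q} \<subseteq> \<Delta>" "\<And>t. t \<in> {p..q} \<Longrightarrow> \<bar>t - u\<bar> < \<delta>"
proof -
  obtain z where z: "z \<in> \<Delta>" "z \<noteq> u"
    using nondegenerate_subinterval_has_other_point[OF \<Delta>] .
  define l where "l = max (min u z) (u - \<delta>)"
  define r where "r = min (max u z) (u + \<delta>)"
  have "l < r" using z d by (auto simp: l_def r_def)
  then obtain p where p: "p \<in> \<rat>" "l < p" "p < r" using Rats_dense_in_real by blast
  then obtain q where q: "q \<in> \<rat>" "p < q" "q < r" using Rats_dense_in_real by blast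
  have "{p..q} \<subseteq> \<Delta>"
  proof
    fix t assume "t \<in> {p..q}"
    then have "min u z \<le> t" "t \<le> max u z" using p q by (auto simp: l_def r_def)
    then show "t \<in> \<Delta>"
      using \<Delta> u z unfolding nondegenerate_subinterval_def is_interval_1
      by (metis min_def max_def)
  qed
  moreover have "\<bar>t - u\<bar> < \<delta>" if "t \<in> {p..q}" for t
    using that p q by (auto simp: l_def r_def abs_less_iff)
  ultimately show ?thesis using p q that by blast
qed

lemma squared_norm_diff_eq:
  fixes x y :: "'i \<Rightarrow> real"
  shows "(\<Sum>i\<in>I. (x i)\<^sup>2) - (\<Sum>i\<in>I. (y i)\<^sup>2) = (\<Sum>i\<in>I. (x i - y i) * (x i + y i))"
  by (simp add: sum_subtractf[symmetric] power2_eq_square algebra_simps)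

lemma abs_inner_le: "\<bar>\<Sum>i\<in>I. x i * y i\<bar> \<le> L2_set x I * L2_set y I" for x y :: "'i \<Rightarrow> real"
  by (rule order_trans[OF sum_abs]) (simp add: abs_mult L2_set_mult_ineq)

text \<open>Near \<open>c\<close> the gradient of the squared norm is about \<open>2 * c\<close>, and \<open>c\<close> is about its length times \<open>a\<close>. So
the increment of the squared norm is at least \<open>2 * L2_set c I\<close> times the increment in direction \<open>a\<close>, up
to errors of the order of \<open>\<epsilon>\<close> times the length of the whole increment.\<close>

lemma squared_norm_increment_ge:
  fixes x y c a :: "'i \<Rightarrow> real"
  assumes "L2_set (\<lambda>i. x i - c i) I \<le> \<epsilon>" "L2_set (\<lambda>i. y i - c i) I \<le> \<epsilon>"
    and "L2_set (\<lambda>i. c i - L2_set c I * a i) I \<le> \<epsilon> * L2_set c I"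
    and a: "m * (1 - \<epsilon>) \<le> (\<Sum>i\<in>I. a i * (x i - y i))"
    and w: "L2_set (\<lambda>i. x i - y i) I \<le> 3 * m" and eps: "0 < \<epsilon>"
  shows "(2 * L2_set c I - 8 * \<epsilon> * (L2_set c I + 1)) * m \<le> (\<Sum>i\<in>I. (x i)\<^sup>2) - (\<Sum>i\<in>I. (y i)\<^sup>2)"
proof -
  let ?c = "L2_set c I" let ?w = "\<lambda>i. x i - y i"
  have w0: "0 \<le> L2_set ?w I" "0 \<le> ?c" by (rule L2_set_nonneg)+
  have m: "0 \<le> m" using w w0 by linarith
  have small: "- (3 * m * e) \<le> (\<Sum>i\<in>I. ?w i * z i)" if "L2_set z I \<le> e" for z e
  proof -
    have "\<bar>\<Sum>i\<in>I. ?w i * z i\<bar> \<le> L2_set ?w I * L2_set z I" by (rule abs_inner_le)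
    also have "\<dots> \<le> 3 * m * e"
      using w w0 that m by (intro mult_mono) (auto simp: L2_set_nonneg)
    finally show ?thesis by linarith
  qed
  have "2 * ?c * (m * (1 - \<epsilon>)) \<le> 2 * ?c * (\<Sum>i\<in>I. a i * ?w i)"
    using a w0 by (intro mult_left_mono) auto
  moreover have "(\<Sum>i\<in>I. (x i)\<^sup>2) - (\<Sum>i\<in>I. (y i)\<^sup>2) = 2 * ?c * (\<Sum>i\<in>I. a i * ?w i)
      + 2 * (\<Sum>i\<in>I. ?w i * (c i - ?c * a i)) + (\<Sum>i\<in>I. ?w i * (x i - c i)) + (\<Sum>i\<in>I. ?w i * (y i - c i))"
    unfolding squared_norm_diff_eq by (simp add: sum_distrib_left sum.distrib[symmetric] algebra_simps)
  moreover note small[OF assms(1)] small[OF assms(2)] small[OF assms(3)]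
  ultimately have "2 * ?c * (m * (1 - \<epsilon>)) - 2 * (3 * m * (\<epsilon> * ?c)) - 2 * (3 * m * \<epsilon>)
      \<le> (\<Sum>i\<in>I. (x i)\<^sup>2) - (\<Sum>i\<in>I. (y i)\<^sup>2)"
    by linarith
  moreover have "(2 * ?c - 8 * \<epsilon> * (?c + 1)) * m \<le> 2 * ?c * (m * (1 - \<epsilon>)) - 2 * (3 * m * (\<epsilon> * ?c)) - 2 * (3 * m * \<epsilon>)"
    using m eps by (simp add: algebra_simps)
  ultimately show ?thesis by linarith
qed

text \<open>The pathwise core of the proof. For the upper bound write the increment of the squared norm as the
inner product of \<open>f u - f v\<close> and \<open>f u + f v\<close>; the first factor has length at most about \<open>\<phi> \<bar>u - v\<bar>\<close>, the
second at most twice the supremum. The lower bound is attained close to a point \<open>u0\<close> that almost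
realises the supremum, by increments that are nearly as large as possible in the direction of \<open>f u0\<close>.\<close>

lemma squared_norm_increment_sup_tendsto:
  fixes f :: "'i \<Rightarrow> real \<Rightarrow> real"
  assumes f: "\<And>i. i \<in> I \<Longrightarrow> continuous_on {0..1} (f i)"
    and \<Delta>: "nondegenerate_subinterval \<Delta>"
    and pos: "\<And>x. x \<in> {0..1} \<Longrightarrow> \<phi> x > 0"
    and net: "\<And>\<epsilon>. \<epsilon> > 0 \<Longrightarrow> \<exists>A\<subseteq>D. finite A \<and> direction_net I \<epsilon> A"
    and conv: "\<And>a. a \<in> D \<Longrightarrow> (increment_sup \<phi> \<Delta> (\<lambda>t. \<Sum>i\<in>I. a i * f i t) \<longlongrightarrow> 1) (at_right 0)"
    and conv_rat: "\<And>a p q. a \<in> D \<Longrightarrow> p \<in> \<rat> \<Longrightarrow> q \<in> \<rat> \<Longrightarrow> p < q \<Longrightarrow> {p..q} \<subseteq> \<Delta> \<Longrightarrow>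
      (increment_sup \<phi> {p..q} (\<lambda>t. \<Sum>i\<in>I. a i * f i t) \<longlongrightarrow> 1) (at_right 0)"
  shows "(increment_sup \<phi> \<Delta> (\<lambda>t. \<Sum>i\<in>I. (f i t)\<^sup>2) \<longlongrightarrow>
    2 * (SUP u\<in>\<Delta>. ereal (L2_set (\<lambda>i. f i u) I))) (at_right 0)"
proof -
  define r where "r u = L2_set (\<lambda>i. f i u) I" for u
  have r_nonneg: "r u \<ge> 0" for u by (simp add: r_def L2_set_nonneg)
  have \<Delta>01: "\<Delta> \<subseteq> {0..1}" using \<Delta> by (simp add: nondegenerate_subinterval_def)
  have dist_pos: "\<phi> \<bar>u - v\<bar> > 0" if "u \<in> \<Delta>" "v \<in> \<Delta>" for u v
    using pos[of "\<bar>u - v\<bar>"] subsetD[OF \<Delta>01 that(1)] subsetD[OF \<Delta>01 that(2)] by auto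
  have norm_bound: "\<forall>\<^sub>F h in at_right 0. \<forall>u\<in>\<Delta>. \<forall>v\<in>\<Delta>. \<bar>u - v\<bar> \<le> h \<longrightarrow>
      L2_set (\<lambda>i. f i u - f i v) I \<le> (1 + 4 * \<epsilon>) * \<phi> \<bar>u - v\<bar>" if eps: "0 < \<epsilon>" "\<epsilon> \<le> 1/2" for \<epsilon>
  proof -
    obtain A where A: "A \<subseteq> D" "finite A" "direction_net I \<epsilon> A"
      using net[OF eps(1)] by blast
    show ?thesis
      by (rule norm_increment_eventually_le[OF A(2,3) eps pos \<Delta>01 conv]) (use A(1) in auto)
  qed
  have "continuous_on {0..1} r"
    unfolding r_def L2_set_def by (intro continuous_intros f) auto
  then have "compact (r ` {0..1})" by (intro compact_continuous_image) auto
  then obtain B where B: "\<And>u. u \<in> {0..1} \<Longrightarrow> r u \<le> B"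
    by (meson bounded_has_Sup(1) compact_imp_bounded imageI bdd_above.E bounded_imp_bdd_above)
  obtain z where z: "z \<in> \<Delta>" using nondegenerate_subinterval_has_other_point[OF \<Delta>] .
  obtain s where s: "(SUP u\<in>\<Delta>. ereal (r u)) = ereal s"
  proof (rule that, rule ereal_real'[symmetric])
    have "ereal (r z) \<le> (SUP u\<in>\<Delta>. ereal (r u))" by (rule SUP_upper[OF z])
    moreover have "(SUP u\<in>\<Delta>. ereal (r u)) \<le> ereal B" using B \<Delta>01 by (intro SUP_least) auto
    ultimately show "\<bar>SUP u\<in>\<Delta>. ereal (r u)\<bar> \<noteq> \<infinity>" by auto
  qed
  have r_le: "r u \<le> s" if "u \<in> \<Delta>" for u
    using SUP_upper[OF that, of "\<lambda>u. ereal (r u)"] by (simp add: s)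
  have s_nonneg: "s \<ge> 0" using r_le[OF z] r_nonneg[of z] by linarith
  let ?Y = "\<lambda>t. \<Sum>i\<in>I. (f i t)\<^sup>2"
  have "(increment_sup \<phi> \<Delta> ?Y \<longlongrightarrow> ereal (2 * s)) (at_right 0)"
  proof (rule order_tendstoI)
    fix y assume "ereal (2 * s) < y"
    then obtain x where x: "2 * s < x" "ereal x < y" using ereal_dense2 by force
    \<comment> \<open>small enough for \<open>(1 + 4 * \<epsilon>) * (2 * s) \<le> x\<close>; the \<open>+ 1\<close> avoids division by zero\<close>
    define \<epsilon> where "\<epsilon> = min (1/2) ((x - 2 * s) / (8 * (s + 1)))"
    have eps: "0 < \<epsilon>" "\<epsilon> \<le> 1/2"
      using x s_nonneg unfolding \<epsilon>_def by (simp_all only: min.cobounded1) simp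
    have "\<epsilon> \<le> (x - 2 * s) / (8 * (s + 1))" unfolding \<epsilon>_def by (rule min.cobounded2)
    then have "\<epsilon> * (8 * (s + 1)) \<le> x - 2 * s"
      using s_nonneg by (subst (asm) pos_le_divide_eq) auto
    then have x_ge: "(1 + 4 * \<epsilon>) * (2 * s) \<le> x" using eps by (simp add: algebra_simps)
    show "\<forall>\<^sub>F h in at_right 0. increment_sup \<phi> \<Delta> ?Y h < y"
      using norm_bound[OF eps]
    proof (rule eventually_mono)
      fix h assume h: "\<forall>u\<in>\<Delta>. \<forall>v\<in>\<Delta>. \<bar>u - v\<bar> \<le> h \<longrightarrow>
        L2_set (\<lambda>i. f i u - f i v) I \<le> (1 + 4 * \<epsilon>) * \<phi> \<bar>u - v\<bar>"
      have "increment_sup \<phi> \<Delta> ?Y h \<le> ereal x"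
        unfolding increment_sup_def
      proof (rule SUP_least, clarsimp)
        fix u v assume uv: "u \<in> \<Delta>" "v \<in> \<Delta>" "\<bar>u - v\<bar> \<le> h"
        have "?Y u - ?Y v \<le> L2_set (\<lambda>i. f i u - f i v) I * L2_set (\<lambda>i. f i u + f i v) I"
          unfolding squared_norm_diff_eq by (rule order_trans[OF abs_ge_self abs_inner_le])
        also have "\<dots> \<le> ((1 + 4 * \<epsilon>) * \<phi> \<bar>u - v\<bar>) * (2 * s)"
        proof (rule mult_mono)
          have "L2_set (\<lambda>i. f i u + f i v) I \<le> r u + r v"
            unfolding r_def by (rule L2_set_triangle_ineq)
          then show "L2_set (\<lambda>i. f i u + f i v) I \<le> 2 * s" using r_le[OF uv(1)] r_le[OF uv(2)] by linarith
        qed (use h uv eps dist_pos[OF uv(1,2)] in \<open>auto simp: L2_set_nonneg\<close>)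
        also have "\<dots> = ((1 + 4 * \<epsilon>) * (2 * s)) * \<phi> \<bar>u - v\<bar>" by simp
        also have "\<dots> \<le> x * \<phi> \<bar>u - v\<bar>"
          using x_ge dist_pos[OF uv(1,2)] by (intro mult_right_mono) auto
        finally show "(?Y u - ?Y v) / \<phi> \<bar>u - v\<bar> \<le> x"
          using dist_pos[OF uv(1,2)] by (simp only: pos_divide_le_eq)
      qed
      then show "increment_sup \<phi> \<Delta> ?Y h < y" using x(2) by (rule le_less_trans)
    qed
  next
    fix y assume "y < ereal (2 * s)"
    then obtain x where x: "y < ereal x" "x < 2 * s" using ereal_dense2 by force
    show "\<forall>\<^sub>F h in at_right 0. y < increment_sup \<phi> \<Delta> ?Y h"
    \<comment> \<open>the pair \<open>u = v\<close> always contributes 0; for \<open>x \<ge> 0\<close> the supremum is positive\<close>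
    proof (cases "x < 0")
      case True
      have "y < increment_sup \<phi> \<Delta> ?Y h" if "h > 0" for h
      proof -
        have "ereal x < ereal ((?Y z - ?Y z) / \<phi> \<bar>z - z\<bar>)" using True by simp
        also have "\<dots> \<le> increment_sup \<phi> \<Delta> ?Y h"
          by (rule increment_le_increment_sup) (use z that in auto)
        finally show ?thesis using x(1) by (meson less_trans)
      qed
      then show ?thesis by (simp add: eventually_at_filter)
    next
      case False
      have "ereal (x / 2) < (SUP u\<in>\<Delta>. ereal (r u))" using x(2) by (simp add: s)
      then obtain u0 where u0: "u0 \<in> \<Delta>" "x / 2 < r u0" by (auto simp: less_SUP_iff)
      define c where "c = r u0"
      have c: "x < 2 * c" "c > 0" using u0 False by (auto simp: c_def)
      define \<epsilon> where "\<epsilon> = min (1/2) ((2 * c - x) / (8 * (c + 1)))"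
      have eps: "0 < \<epsilon>" "\<epsilon> \<le> 1/2"
        using c unfolding \<epsilon>_def by (simp_all only: min.cobounded1) simp
      have "\<epsilon> \<le> (2 * c - x) / (8 * (c + 1))" unfolding \<epsilon>_def by (rule min.cobounded2)
      then have "\<epsilon> * (8 * (c + 1)) \<le> 2 * c - x"
        using c by (subst (asm) pos_le_divide_eq) auto
      then have x_le: "x \<le> 2 * c - 8 * \<epsilon> * (c + 1)" by (simp add: algebra_simps)
      obtain a where a: "a \<in> D" "L2_set (\<lambda>i. f i u0 - c * a i) I \<le> \<epsilon> * c"
        using net[OF eps(1)] c(2) unfolding c_def r_def direction_net_def by blast
      define g where "g t = L2_set (\<lambda>i. f i t - f i u0) I" for t
      have "continuous_on {0..1} g"
        unfolding g_def L2_set_def by (intro continuous_intros f) auto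
      moreover have "u0 \<in> {0..1}" "g u0 = 0" using u0 \<Delta>01 by (auto simp: g_def L2_set_def)
      ultimately obtain \<delta> where \<delta>: "\<delta> > 0" "\<And>t. t \<in> {0..1} \<Longrightarrow> \<bar>t - u0\<bar> < \<delta> \<Longrightarrow> \<bar>g t\<bar> < \<epsilon>"
        unfolding continuous_on_iff dist_real_def using eps(1) by (metis diff_zero)
      obtain p q where pq: "p \<in> \<rat>" "q \<in> \<rat>" "p < q" "{p..q} \<subseteq> \<Delta>" "\<And>t. t \<in> {p..q} \<Longrightarrow> \<bar>t - u0\<bar> < \<delta>"
        using rational_subinterval_near[OF \<Delta> u0(1) \<delta>(1)] by blast
      have near: "L2_set (\<lambda>i. f i t - f i u0) I \<le> \<epsilon>" if "t \<in> {p..q}" for t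
      proof -
        have "t \<in> {0..1}" using that pq(4) \<Delta>01 by blast
        then have "\<bar>g t\<bar> < \<epsilon>" using pq(5)[OF that] by (rule \<delta>(2))
        then show ?thesis unfolding g_def by linarith
      qed
      have "\<forall>\<^sub>F h in at_right 0. ereal (1 - \<epsilon>) < increment_sup \<phi> {p..q} (\<lambda>t. \<Sum>i\<in>I. a i * f i t) h"
        using eps by (intro order_tendstoD(1)[OF conv_rat[OF a(1) pq(1-4)]]) auto
      from this norm_bound[OF eps] show ?thesis
      proof (rule eventually_elim2)
        fix h
        assume "ereal (1 - \<epsilon>) < increment_sup \<phi> {p..q} (\<lambda>t. \<Sum>i\<in>I. a i * f i t) h"
        then obtain u v where uv: "u \<in> {p..q}" "v \<in> {p..q}" "\<bar>u - v\<bar> \<le> h"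
          and dir: "1 - \<epsilon> < ((\<Sum>i\<in>I. a i * f i u) - (\<Sum>i\<in>I. a i * f i v)) / \<phi> \<bar>u - v\<bar>"
          unfolding increment_sup_def by (auto simp: less_SUP_iff)
        have uv\<Delta>: "u \<in> \<Delta>" "v \<in> \<Delta>" using uv pq by auto
        let ?m = "\<phi> \<bar>u - v\<bar>"
        have m: "?m > 0" by (rule dist_pos[OF uv\<Delta>])
        assume "\<forall>u\<in>\<Delta>. \<forall>v\<in>\<Delta>. \<bar>u - v\<bar> \<le> h \<longrightarrow> L2_set (\<lambda>i. f i u - f i v) I \<le> (1 + 4 * \<epsilon>) * \<phi> \<bar>u - v\<bar>"
        then have "L2_set (\<lambda>i. f i u - f i v) I \<le> (1 + 4 * \<epsilon>) * ?m" using uv uv\<Delta> by blast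
        also have "\<dots> \<le> 3 * ?m" using eps m by (intro mult_right_mono) auto
        finally have w: "L2_set (\<lambda>i. f i u - f i v) I \<le> 3 * ?m" .
        have "?m * (1 - \<epsilon>) \<le> (\<Sum>i\<in>I. a i * (f i u - f i v))"
          using dir m by (simp add: pos_less_divide_eq right_diff_distrib sum_subtractf mult.commute)
        from squared_norm_increment_ge[OF near[OF uv(1)] near[OF uv(2)] _ this w eps(1)] a(2)
        have "(2 * c - 8 * \<epsilon> * (c + 1)) * ?m \<le> ?Y u - ?Y v"
          by (simp add: c_def r_def)
        moreover have "x * ?m \<le> (2 * c - 8 * \<epsilon> * (c + 1)) * ?m"
          using x_le m by (intro mult_right_mono) auto
        ultimately have "x \<le> (?Y u - ?Y v) / ?m"
          using m by (simp only: pos_le_divide_eq)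
        then have "ereal x \<le> ereal ((?Y u - ?Y v) / ?m)" by simp
        also have "\<dots> \<le> increment_sup \<phi> \<Delta> ?Y h"
          by (rule increment_le_increment_sup) (use uv uv\<Delta> in auto)
        finally show "y < increment_sup \<phi> \<Delta> ?Y h" using x(1) by (rule less_le_trans[rotated])
      qed
    qed
  qed
  moreover have "ereal (2 * s) = 2 * (SUP u\<in>\<Delta>. ereal (L2_set (\<lambda>i. f i u) I))"
    using s by (simp add: r_def)
  ultimately show ?thesis by simp
qed

section \<open>Uniqueness of laws from linear combinations\<close>

text \<open>A bounded nonnegative weight \<open>Z\<close>, once normalised, is a change of measure, which makes weighted
expectations accessible to statements about probability laws on the line.\<close>

lemma tilted_law:
  fixes X Z :: "'a \<Rightarrow> real" and K :: real
  assumes "prob_space M"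
    and [measurable]: "Z \<in> borel_measurable M" "X \<in> borel_measurable M"
    and Z: "\<And>\<omega>. 0 \<le> Z \<omega>" "\<And>\<omega>. Z \<omega> \<le> K" and z: "(\<integral>\<omega>. Z \<omega> \<partial>M) > 0"
  defines "P \<equiv> distr (density M (\<lambda>\<omega>. ennreal (Z \<omega> / (\<integral>\<omega>. Z \<omega> \<partial>M)))) borel X"
  shows "real_distribution P"
    and "char P s = (\<integral>\<omega>. of_real (Z \<omega>) * iexp (s * X \<omega>) \<partial>M) / of_real (\<integral>\<omega>. Z \<omega> \<partial>M)"
    and "B \<in> sets borel \<Longrightarrow> measure P B = (\<integral>\<omega>. Z \<omega> * indicator B (X \<omega>) \<partial>M) / (\<integral>\<omega>. Z \<omega> \<partial>M)"
proof -
  interpret M: prob_space M by fact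
  define z where "z = (\<integral>\<omega>. Z \<omega> \<partial>M)"
  have z0: "z > 0" using assms by (simp add: z_def)
  have "integrable M Z"
    by (rule M.integrable_const_bound[where B = K]) (use Z in auto)
  then have "integrable M (\<lambda>\<omega>. Z \<omega> / z)" by simp
  then have "(\<integral>\<^sup>+\<omega>. ennreal (Z \<omega> / z) \<partial>M) = ennreal (\<integral>\<omega>. Z \<omega> / z \<partial>M)"
    using Z z0 by (intro nn_integral_eq_integral) auto
  also have "\<dots> = 1" using z0 by (simp add: z_def)
  finally have "prob_space (density M (\<lambda>\<omega>. ennreal (Z \<omega> / z)))"
    by (intro prob_spaceI) (simp add: emeasure_density)
  then interpret Q: prob_space "density M (\<lambda>\<omega>. ennreal (Z \<omega> / z))" .
  show P: "real_distribution P"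
    unfolding P_def z_def[symmetric] by (rule Q.real_distribution_distr) simp
  have int: "(\<integral>x. f x \<partial>P) = (\<integral>\<omega>. (Z \<omega> / z) *\<^sub>R f (X \<omega>) \<partial>M)"
    if [measurable]: "f \<in> borel_measurable borel" for f :: "real \<Rightarrow> 'c :: {banach, second_countable_topology}"
    unfolding P_def z_def[symmetric] using Z z0
    by (subst integral_distr) (auto intro!: integral_density)
  show "char P s = (\<integral>\<omega>. of_real (Z \<omega>) * iexp (s * X \<omega>) \<partial>M) / of_real z"
    unfolding char_def by (subst int) (auto simp: scaleR_conv_of_real)
  assume B[measurable]: "B \<in> sets borel"
  interpret P: real_distribution P by (rule P)
  have "measure P B = (\<integral>x. indicator B x \<partial>P)" by (simp add: P_def)
  then show "measure P B = (\<integral>\<omega>. Z \<omega> * indicator B (X \<omega>) \<partial>M) / z"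
    by (subst (asm) int) auto
qed

lemma weighted_Levy_uniqueness:
  fixes X Z :: "'a \<Rightarrow> real" and Y W :: "'b \<Rightarrow> real" and K :: real
  assumes M: "prob_space M" and N: "prob_space N"
    and Z: "Z \<in> borel_measurable M" "\<And>\<omega>. 0 \<le> Z \<omega>" "\<And>\<omega>. Z \<omega> \<le> K"
    and W: "W \<in> borel_measurable N" "\<And>\<omega>. 0 \<le> W \<omega>" "\<And>\<omega>. W \<omega> \<le> K"
    and X: "X \<in> borel_measurable M" and Y: "Y \<in> borel_measurable N"
    and eq: "\<And>s. (\<integral>\<omega>. of_real (Z \<omega>) * iexp (s * X \<omega>) \<partial>M) = (\<integral>\<omega>. of_real (W \<omega>) * iexp (s * Y \<omega>) \<partial>N)"
    and B: "B \<in> sets borel"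
  shows "(\<integral>\<omega>. Z \<omega> * indicator B (X \<omega>) \<partial>M) = (\<integral>\<omega>. W \<omega> * indicator B (Y \<omega>) \<partial>N)"
proof -
  interpret M: prob_space M by fact
  interpret N: prob_space N by fact
  have z: "(\<integral>\<omega>. Z \<omega> \<partial>M) = (\<integral>\<omega>. W \<omega> \<partial>N)" (is "?z = ?w")
    using eq[of 0] by simp
  have int: "integrable M Z" "integrable N W"
    using Z W by (auto intro!: M.integrable_const_bound[where B = K] N.integrable_const_bound[where B = K])
  show ?thesis
  proof (cases "?z > 0")
    case True
    then have "?w > 0" using z by simp
    note lawM = tilted_law[OF M Z(1) X Z(2,3) True] and lawN = tilted_law[OF N W(1) Y W(2,3) this]
    have "distr (density M (\<lambda>\<omega>. ennreal (Z \<omega> / ?z))) borel X = distr (density N (\<lambda>\<omega>. ennreal (W \<omega> / ?w))) borel Y"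
    proof (rule Levy_uniqueness[OF lawM(1) lawN(1)], rule ext)
      show "char (distr (density M (\<lambda>\<omega>. ennreal (Z \<omega> / ?z))) borel X) s =
          char (distr (density N (\<lambda>\<omega>. ennreal (W \<omega> / ?w))) borel Y) s" for s
        unfolding lawM(2) lawN(2) eq by (simp only: z)
    qed
    then have "(\<integral>\<omega>. Z \<omega> * indicator B (X \<omega>) \<partial>M) / ?z = (\<integral>\<omega>. W \<omega> * indicator B (Y \<omega>) \<partial>N) / ?w"
      using lawM(3)[OF B] lawN(3)[OF B] by simp
    then show ?thesis using True z by simp
  next
    case False
    moreover have "?z \<ge> 0" using Z by simp
    ultimately have "?z = 0" "?w = 0" using z by auto
    then have "AE \<omega> in M. Z \<omega> = 0" "AE \<omega> in N. W \<omega> = 0"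
      using integral_nonneg_eq_0_iff_AE int Z W by (metis AE_I2)+
    then have "AE \<omega> in M. Z \<omega> * indicator B (X \<omega>) = 0" "AE \<omega> in N. W \<omega> * indicator B (Y \<omega>) = 0" by auto
    then show ?thesis by (simp add: integral_eq_zero_AE)
  qed
qed

text \<open>The Cramer-Wold principle. Coordinates pass one at a time from the exponential to the indicators, by
one-dimensional uniqueness in the coordinate \<open>j\<close>. The remaining exponential \<open>iexp (\<theta> \<omega>)\<close> is not a
nonnegative weight, but \<open>1 + cos (\<theta> \<omega>)\<close> and \<open>1 + sin (\<theta> \<omega>)\<close> are, and they determine it.\<close>

lemma joint_law_unique_of_linear_combinations:
  fixes X :: "'i \<Rightarrow> 'a \<Rightarrow> real" and Y :: "'i \<Rightarrow> 'b \<Rightarrow> real"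
  assumes M: "prob_space M" and N: "prob_space N" and J: "finite J"
    and X[measurable]: "\<And>i. i \<in> J \<Longrightarrow> X i \<in> borel_measurable M"
    and Y[measurable]: "\<And>i. i \<in> J \<Longrightarrow> Y i \<in> borel_measurable N"
    and comb: "\<And>c. (\<integral>\<omega>. iexp (\<Sum>i\<in>J. c i * X i \<omega>) \<partial>M) = (\<integral>\<omega>. iexp (\<Sum>i\<in>J. c i * Y i \<omega>) \<partial>N)"
    and B: "\<And>i. i \<in> J \<Longrightarrow> B i \<in> sets borel"
  shows "(\<integral>\<omega>. (\<Prod>i\<in>J. indicator (B i) (X i \<omega>)) \<partial>M) = (\<integral>\<omega>. (\<Prod>i\<in>J. indicator (B i) (Y i \<omega>) :: real) \<partial>N)"
proof -
  interpret M: prob_space M by fact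
  interpret N: prob_space N by fact
  define p where "p L \<omega> = (\<Prod>i\<in>L. indicator (B i) (X i \<omega>) :: real)" for L \<omega>
  define q where "q L \<omega> = (\<Prod>i\<in>L. indicator (B i) (Y i \<omega>) :: real)" for L \<omega>
  have p01: "0 \<le> p L \<omega>" "p L \<omega> \<le> 1" and q01: "0 \<le> q L \<omega>'" "q L \<omega>' \<le> 1" for L \<omega> \<omega>'
    by (auto simp: p_def q_def intro!: prod_nonneg prod_le_1)
  have p_meas: "p L \<in> borel_measurable M" and q_meas: "q L \<in> borel_measurable N" if "L \<subseteq> J" for L
    using B that X Y unfolding p_def q_def
    by (auto intro!: borel_measurable_prod borel_measurable_indicator' simp: measurable_sets_borel subset_iff)
  have "(\<integral>\<omega>. of_real (p L \<omega>) * iexp (\<Sum>i\<in>J-L. c i * X i \<omega>) \<partial>M) =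
      (\<integral>\<omega>. of_real (q L \<omega>) * iexp (\<Sum>i\<in>J-L. c i * Y i \<omega>) \<partial>N)" if "L \<subseteq> J" for L c
    using finite_subset[OF that J] that
  proof (induction L arbitrary: c rule: finite_induct)
    case empty
    then show ?case using comb by (simp add: p_def q_def)
  next
    case (insert j L)
    then have L: "L \<subseteq> J" "j \<in> J" "j \<notin> L" by auto
    define R where "R = J - insert j L"
    have R: "J - L = insert j R" "j \<notin> R" "finite R" "R \<subseteq> J" using L J by (auto simp: R_def)
    note [measurable] = p_meas[OF L(1)] q_meas[OF L(1)] X[OF L(2)] Y[OF L(2)]
    define \<theta> where "\<theta> \<omega> = (\<Sum>i\<in>R. c i * X i \<omega>)" for \<omega>
    define \<theta>' where "\<theta>' \<omega> = (\<Sum>i\<in>R. c i * Y i \<omega>)" for \<omega>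
    have [measurable]: "\<theta> \<in> borel_measurable M" "\<theta>' \<in> borel_measurable N"
      using R X Y by (auto simp: \<theta>_def[abs_def] \<theta>'_def[abs_def] intro!: borel_measurable_sum borel_measurable_times)
    have IH: "(\<integral>\<omega>. of_real (p L \<omega>) * iexp (s * X j \<omega> + e * \<theta> \<omega>) \<partial>M) =
        (\<integral>\<omega>. of_real (q L \<omega>) * iexp (s * Y j \<omega> + e * \<theta>' \<omega>) \<partial>N)" for s e
    proof -
      define d where "d = (\<lambda>i. if i = j then s else e * c i)"
      have "d i = e * c i" if "i \<in> R" for i using that R(2) by (auto simp: d_def)
      moreover have "d j = s" by (simp add: d_def)
      ultimately have "(\<Sum>i\<in>J-L. d i * V i) = s * V j + e * (\<Sum>i\<in>R. c i * V i)" for V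
        unfolding R(1) using R \<open>j \<notin> R\<close> by (simp add: sum_distrib_left mult.assoc)
      then show ?thesis
        using insert.IH[OF L(1), of d] unfolding \<theta>_def \<theta>'_def by (simp only:)
    qed
    define Z where "Z g \<omega> = p L \<omega> * (1 + g (\<theta> \<omega>))" for g \<omega>
    define W where "W g \<omega> = q L \<omega> * (1 + g (\<theta>' \<omega>))" for g \<omega>
    have Bj: "B j \<in> sets borel" using B L by auto
    \<comment> \<open>the cases \<open>g = cos\<close>, \<open>g = sin\<close> and \<open>g = 0\<close>; \<open>expand\<close> writes \<open>g\<close> by exponentials, to which \<open>IH\<close> applies\<close>
    have step: "(\<integral>\<omega>. Z g \<omega> * indicator (B j) (X j \<omega>) \<partial>M) = (\<integral>\<omega>. W g \<omega> * indicator (B j) (Y j \<omega>) \<partial>N)"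
      if [measurable]: "g \<in> borel_measurable borel" and g: "\<And>x. \<bar>g x\<bar> \<le> 1"
        and expand: "\<And>x y. of_real (g x) * iexp y = \<alpha> * iexp (y + 1 * x) + \<beta> * iexp (y + (-1) * x)" for g \<alpha> \<beta>
    proof (rule weighted_Levy_uniqueness[where K = 2, OF M N])
      have g1: "0 \<le> 1 + g x" "1 + g x \<le> 2" for x using g[of x] by auto
      show "0 \<le> Z g \<omega>" "0 \<le> W g \<omega>'" "Z g \<omega> \<le> 2" "W g \<omega>' \<le> 2" for \<omega> \<omega>'
        using mult_mono[OF p01(2) g1(2)] mult_mono[OF q01(2) g1(2)] g1 p01 q01
        by (auto simp: Z_def W_def)
      show "Z g \<in> borel_measurable M" "W g \<in> borel_measurable N" "X j \<in> borel_measurable M" "Y j \<in> borel_measurable N"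
        unfolding Z_def[abs_def] W_def[abs_def] by measurable
      show "B j \<in> sets borel" by (rule Bj)
      fix s
      have intM: "integrable M (\<lambda>\<omega>. complex_of_real (p L \<omega>) * iexp (s * X j \<omega> + e * \<theta> \<omega>))" for e
        by (rule M.integrable_const_bound[where B = 1]) (use p01 in \<open>auto simp: norm_mult\<close>)
      have intN: "integrable N (\<lambda>\<omega>. complex_of_real (q L \<omega>) * iexp (s * Y j \<omega> + e * \<theta>' \<omega>))" for e
        by (rule N.integrable_const_bound[where B = 1]) (use q01 in \<open>auto simp: norm_mult\<close>)
      have expZ: "of_real (Z g \<omega>) * iexp (s * X j \<omega>) = of_real (p L \<omega>) * iexp (s * X j \<omega> + 0 * \<theta> \<omega>)
          + (\<alpha> * (of_real (p L \<omega>) * iexp (s * X j \<omega> + 1 * \<theta> \<omega>)) + \<beta> * (of_real (p L \<omega>) * iexp (s * X j \<omega> + (-1) * \<theta> \<omega>)))" for \<omega>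
        unfolding Z_def using arg_cong[OF expand[of "\<theta> \<omega>" "s * X j \<omega>"], of "\<lambda>x. of_real (p L \<omega>) * x"]
        by (simp add: algebra_simps)
      have expW: "of_real (W g \<omega>) * iexp (s * Y j \<omega>) = of_real (q L \<omega>) * iexp (s * Y j \<omega> + 0 * \<theta>' \<omega>)
          + (\<alpha> * (of_real (q L \<omega>) * iexp (s * Y j \<omega> + 1 * \<theta>' \<omega>)) + \<beta> * (of_real (q L \<omega>) * iexp (s * Y j \<omega> + (-1) * \<theta>' \<omega>)))" for \<omega>
        unfolding W_def using arg_cong[OF expand[of "\<theta>' \<omega>" "s * Y j \<omega>"], of "\<lambda>x. of_real (q L \<omega>) * x"]
        by (simp add: algebra_simps)
      show "(\<integral>\<omega>. of_real (Z g \<omega>) * iexp (s * X j \<omega>) \<partial>M) = (\<integral>\<omega>. of_real (W g \<omega>) * iexp (s * Y j \<omega>) \<partial>N)"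
        unfolding expZ expW
        by (simp only: Bochner_Integration.integral_add Bochner_Integration.integrable_add
            integrable_mult_right integral_mult_right_zero intM intN IH)
    qed
    have step0: "(\<integral>\<omega>. p L \<omega> * indicator (B j) (X j \<omega>) \<partial>M) = (\<integral>\<omega>. q L \<omega> * indicator (B j) (Y j \<omega>) \<partial>N)"
      using step[of "\<lambda>_. 0" 0 0] by (simp add: Z_def W_def)
    have p': "p (insert j L) \<omega> = p L \<omega> * indicator (B j) (X j \<omega>)" and q': "q (insert j L) \<omega>' = q L \<omega>' * indicator (B j) (Y j \<omega>')" for \<omega> \<omega>'
      using insert.hyps by (simp_all add: p_def q_def mult.commute)
    have pm: "p (insert j L) \<in> borel_measurable M" "q (insert j L) \<in> borel_measurable N"
      using L by (auto intro!: p_meas q_meas)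
    note [measurable] = pm
    have part: "(\<integral>\<omega>. p (insert j L) \<omega> * g (\<theta> \<omega>) \<partial>M) = (\<integral>\<omega>. q (insert j L) \<omega> * g (\<theta>' \<omega>) \<partial>N)"
      if [measurable]: "g \<in> borel_measurable borel" and g: "\<And>x. \<bar>g x\<bar> \<le> 1"
        and expand: "\<And>x y. of_real (g x) * iexp y = \<alpha> * iexp (y + 1 * x) + \<beta> * iexp (y + (-1) * x)" for g \<alpha> \<beta>
    proof -
      have "integrable M (p (insert j L))" "integrable M (\<lambda>\<omega>. p (insert j L) \<omega> * g (\<theta> \<omega>))"
        using p01 g by (auto intro!: M.integrable_const_bound[where B = 1] simp: abs_mult mult_le_one)
      moreover have "integrable N (q (insert j L))" "integrable N (\<lambda>\<omega>. q (insert j L) \<omega> * g (\<theta>' \<omega>))"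
        using q01 g by (auto intro!: N.integrable_const_bound[where B = 1] simp: abs_mult mult_le_one)
      moreover have "(\<integral>\<omega>. p (insert j L) \<omega> + p (insert j L) \<omega> * g (\<theta> \<omega>) \<partial>M) =
          (\<integral>\<omega>. q (insert j L) \<omega> + q (insert j L) \<omega> * g (\<theta>' \<omega>) \<partial>N)"
        using step[OF that] unfolding Z_def W_def p' q' by (simp add: algebra_simps)
      ultimately show ?thesis using step0 unfolding p'[symmetric] q'[symmetric] by simp
    qed
    have cos: "(\<integral>\<omega>. p (insert j L) \<omega> * cos (\<theta> \<omega>) \<partial>M) = (\<integral>\<omega>. q (insert j L) \<omega> * cos (\<theta>' \<omega>) \<partial>N)"
      by (rule part[of cos "1/2" "1/2"])
        (auto simp: cos_of_real[symmetric] cos_exp_eq exp_add[symmetric] ring_distribs divide_simps add.commute)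
    have sin: "(\<integral>\<omega>. p (insert j L) \<omega> * sin (\<theta> \<omega>) \<partial>M) = (\<integral>\<omega>. q (insert j L) \<omega> * sin (\<theta>' \<omega>) \<partial>N)"
      by (rule part[of sin "1/(2*\<i>)" "-1/(2*\<i>)"])
        (auto simp: sin_of_real[symmetric] sin_exp_eq exp_add exp_diff exp_minus field_simps)
    have split: "of_real a * iexp x = of_real (a * cos x) + \<i> * of_real (a * sin x)" for a x
      by (simp add: exp_Euler cos_of_real sin_of_real algebra_simps)
    have int: "integrable M (\<lambda>\<omega>. p (insert j L) \<omega> * cos (\<theta> \<omega>))" "integrable M (\<lambda>\<omega>. p (insert j L) \<omega> * sin (\<theta> \<omega>))"
      "integrable N (\<lambda>\<omega>. q (insert j L) \<omega> * cos (\<theta>' \<omega>))" "integrable N (\<lambda>\<omega>. q (insert j L) \<omega> * sin (\<theta>' \<omega>))"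
      using p01 q01 by (auto intro!: M.integrable_const_bound[where B = 1] N.integrable_const_bound[where B = 1] simp: abs_mult mult_le_one)
    show ?case
      unfolding R_def[symmetric] \<theta>_def[symmetric] \<theta>'_def[symmetric] split
      using int cos sin by (simp only: Bochner_Integration.integral_add integrable_of_real integrable_mult_right integral_mult_right_zero integral_of_real)
  qed
  from this[of J "\<lambda>_. 0"] show ?thesis
    by (simp add: p_def q_def flip: of_real_prod)
qed

lemma sample_path_measurable:
  "(\<And>t. t \<in> {0..1} \<Longrightarrow> \<xi> t \<in> borel_measurable M) \<Longrightarrow> sample_path \<xi> \<in> measurable M path_space"
  unfolding sample_path_def[abs_def] by (rule measurable_restrict)

lemma path_law_unique_of_linear_combinations:
  assumes M: "prob_space M" and N: "prob_space N"
    and \<eta>[measurable]: "\<And>t. t \<in> {0..1} \<Longrightarrow> \<eta> t \<in> borel_measurable M"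
    and \<xi>[measurable]: "\<And>t. t \<in> {0..1} \<Longrightarrow> \<xi> t \<in> borel_measurable N"
    and comb: "\<And>J c. finite J \<Longrightarrow> J \<subseteq> {0..1} \<Longrightarrow>
      (\<integral>\<omega>. iexp (\<Sum>t\<in>J. c t * \<xi> t \<omega>) \<partial>N) = (\<integral>\<omega>. iexp (\<Sum>t\<in>J. c t * \<eta> t \<omega>) \<partial>M)"
  shows "distr N path_space (sample_path \<xi>) = distr M path_space (sample_path \<eta>)"
proof (rule measure_eqI_PiM_infinite)
  interpret M: prob_space M by fact
  interpret N: prob_space N by fact
  have path_\<xi>: "sample_path \<xi> \<in> measurable N path_space" by (rule sample_path_measurable[OF \<xi>])
  show "finite_measure (distr N path_space (sample_path \<xi>))"
    using N.prob_space_distr[OF path_\<xi>] by (rule prob_space.finite_measure)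
  fix A :: "real \<Rightarrow> real set" and J :: "real set"
  assume J: "finite J" "J \<subseteq> {0..1}" and A: "\<And>i. i \<in> J \<Longrightarrow> A i \<in> sets borel"
  let ?C = "prod_emb {0..1} (\<lambda>_. borel) J (Pi\<^sub>E J A)"
  have C: "?C \<in> sets path_space"
    using J A by (intro sets_PiM_I) auto
  have cyl: "emeasure (distr M' path_space (sample_path \<zeta>)) ?C
      = ennreal (\<integral>\<omega>. (\<Prod>t\<in>J. indicator (A t) (\<zeta> t \<omega>)) \<partial>M')"
    if M': "prob_space M'" and \<zeta>: "\<And>t. t \<in> {0..1} \<Longrightarrow> \<zeta> t \<in> borel_measurable M'" for M' :: "'c measure" and \<zeta>
  proof -
    interpret M': prob_space M' by fact
    have path_\<zeta>: "sample_path \<zeta> \<in> measurable M' path_space" by (rule sample_path_measurable[OF \<zeta>])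
    let ?E = "sample_path \<zeta> -` ?C \<inter> space M'"
    have "?E \<in> sets M'" by (rule measurable_sets[OF path_\<zeta> C])
    then have "measure M' ?E = (\<integral>\<omega>. indicator ?E \<omega> \<partial>M')" by simp
    also have "\<dots> = (\<integral>\<omega>. (\<Prod>t\<in>J. indicator (A t) (\<zeta> t \<omega>)) \<partial>M')"
    proof (rule Bochner_Integration.integral_cong)
      fix \<omega> assume "\<omega> \<in> space M'"
      then have "\<omega> \<in> ?E \<longleftrightarrow> (\<forall>t\<in>J. \<zeta> t \<omega> \<in> A t)"
        using J(2) by (force simp: prod_emb_iff sample_path_def)
      then show "indicator ?E \<omega> = (\<Prod>t\<in>J. indicator (A t) (\<zeta> t \<omega>) :: real)"
        using J(1) by (auto simp: indicator_def prod_zero_iff)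
    qed simp
    finally show ?thesis
      unfolding emeasure_distr[OF path_\<zeta> C] M'.emeasure_eq_measure by (rule arg_cong)
  qed
  have "(\<integral>\<omega>. (\<Prod>t\<in>J. indicator (A t) (\<xi> t \<omega>)) \<partial>N) = (\<integral>\<omega>. (\<Prod>t\<in>J. indicator (A t) (\<eta> t \<omega>) :: real) \<partial>M)"
    by (rule joint_law_unique_of_linear_combinations[OF N M J(1)]) (use J A \<eta> \<xi> comb in auto)
  then show "emeasure (distr N path_space (sample_path \<xi>)) ?C = emeasure (distr M path_space (sample_path \<eta>)) ?C"
    using cyl[OF M, of \<eta>] cyl[OF N, of \<xi>] \<eta> \<xi> by simp
qed simp_all

section \<open>Moduli of continuity depend on the law only\<close>

text \<open>The increment supremum of an arbitrary \<open>\<phi>\<close> is in general not a measurable function on the path space,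
so equality of laws says nothing about it directly. On continuous paths it agrees with a supremum over
countably many pairs, which is measurable; and as it is monotone in \<open>h\<close>, the limit may be taken along the
sequence \<open>1 / (n + 1)\<close>.\<close>

lemma AE_increment_sup_tendsto_transfer:
  assumes M: "prob_space M" and N: "prob_space N"
    and \<eta>: "\<And>t. t \<in> {0..1} \<Longrightarrow> \<eta> t \<in> borel_measurable M"
    and \<xi>: "\<And>t. t \<in> {0..1} \<Longrightarrow> \<xi> t \<in> borel_measurable N"
    and cont: "continuous_process M \<eta>" "continuous_process N \<xi>"
    and law: "distr N path_space (sample_path \<xi>) = distr M path_space (sample_path \<eta>)"
    and \<Delta>: "\<Delta> \<subseteq> {0..1}"
    and lim: "AE \<omega> in M. (increment_sup \<phi> \<Delta> (\<lambda>t. \<eta> t \<omega>) \<longlongrightarrow> l) (at_right 0)"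
  shows "AE \<omega> in N. (increment_sup \<phi> \<Delta> (\<lambda>t. \<xi> t \<omega>) \<longlongrightarrow> l) (at_right 0)"
proof -
  define A where "A n = {(u, v). u \<in> \<Delta> \<and> v \<in> \<Delta> \<and> \<bar>u - v\<bar> \<le> inverse (real (Suc n))}" for n
  have A01: "A n \<subseteq> {0..1} \<times> {0..1}" for n using \<Delta> by (auto simp: A_def)
  define good where "good n T \<longleftrightarrow> countable T \<and> T \<subseteq> A n \<and> (\<forall>f. continuous_on {0..1} f \<longrightarrow>
      (SUP (u, v)\<in>T. ereal ((f u - f v) / \<phi> \<bar>u - v\<bar>)) = (SUP (u, v)\<in>A n. ereal ((f u - f v) / \<phi> \<bar>u - v\<bar>)))" for n T
  have "\<exists>T. good n T" for n
    unfolding good_def by (rule countable_subset_same_weighted_increment_SUP[OF A01])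
  then obtain T where "\<And>n. good n (T n)" by metis
  then have T: "\<And>n. countable (T n)" "\<And>n. T n \<subseteq> A n"
    "\<And>n f. continuous_on {0..1} f \<Longrightarrow>
      (SUP (u, v)\<in>T n. ereal ((f u - f v) / \<phi> \<bar>u - v\<bar>)) = (SUP (u, v)\<in>A n. ereal ((f u - f v) / \<phi> \<bar>u - v\<bar>))"
    unfolding good_def by blast+
  define S where "S n f = (SUP (u, v)\<in>T n. ereal ((f u - f v) / \<phi> \<bar>u - v\<bar>))" for n and f :: "real \<Rightarrow> real"
  define Q where "Q f \<longleftrightarrow> (\<lambda>n. S n f) \<longlonglongrightarrow> l" for f
  have Q_iff: "Q (sample_path \<zeta> \<omega>) \<longleftrightarrow> (increment_sup \<phi> \<Delta> (\<lambda>t. \<zeta> t \<omega>) \<longlongrightarrow> l) (at_right 0)"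
    if "continuous_on {0..1} (\<lambda>t. \<zeta> t \<omega>)" for \<zeta> :: "real \<Rightarrow> 'c \<Rightarrow> real" and \<omega>
  proof -
    have "S n (sample_path \<zeta> \<omega>) = S n (\<lambda>t. \<zeta> t \<omega>)" for n
      unfolding S_def using T(2)[of n] A01[of n] by (intro SUP_cong) (auto simp: sample_path_def)
    also have "S n (\<lambda>t. \<zeta> t \<omega>) = increment_sup \<phi> \<Delta> (\<lambda>t. \<zeta> t \<omega>) (inverse (real (Suc n)))" for n
      unfolding S_def increment_sup_def T(3)[OF that] A_def ..
    finally show ?thesis
      unfolding Q_def by (simp only: mono_tendsto_at_right_0_iff[OF increment_sup_mono])
  qed
  have S_meas[measurable]: "S n \<in> borel_measurable path_space" for n
    unfolding S_def[abs_def] case_prod_beta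
  proof (rule borel_measurable_SUP[OF T(1)])
    fix p assume "p \<in> T n"
    then have [measurable]: "(\<lambda>f. f (fst p)) \<in> borel_measurable path_space" "(\<lambda>f. f (snd p)) \<in> borel_measurable path_space"
      using T(2)[of n] A01[of n] by (auto intro!: measurable_component_singleton)
    show "(\<lambda>f. ereal ((f (fst p) - f (snd p)) / \<phi> \<bar>fst p - snd p\<bar>)) \<in> borel_measurable path_space"
      by measurable
  qed
  have "Q f \<longleftrightarrow> liminf (\<lambda>n. S n f) = l \<and> limsup (\<lambda>n. S n f) = l" for f
    unfolding Q_def by (simp add: tendsto_iff_Liminf_eq_Limsup)
  then have Q_sets: "{f \<in> space path_space. Q f} \<in> sets path_space"
    by simp
  have path_\<eta>: "sample_path \<eta> \<in> measurable M path_space" by (rule sample_path_measurable[OF \<eta>])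
  have path_\<xi>: "sample_path \<xi> \<in> measurable N path_space" by (rule sample_path_measurable[OF \<xi>])
  have "AE \<omega> in M. Q (sample_path \<eta> \<omega>)"
    using lim cont(1) unfolding continuous_process_def by eventually_elim (simp add: Q_iff)
  then have "AE f in distr M path_space (sample_path \<eta>). Q f"
    by (subst AE_distr_iff[OF path_\<eta> Q_sets])
  then have "AE f in distr N path_space (sample_path \<xi>). Q f" by (simp only: law)
  then have "AE \<omega> in N. Q (sample_path \<xi> \<omega>)"
    by (subst (asm) AE_distr_iff[OF path_\<xi> Q_sets])
  then show ?thesis
    using cont(2) unfolding continuous_process_def by eventually_elim (simp add: Q_iff)
qed

section \<open>Gaussian copies and the chi-square process\<close>

lemma gaussian_rv_integrable:
  assumes "prob_space M" and Z: "gaussian_rv M Z"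
  shows "integrable M Z"
proof -
  interpret prob_space M by fact
  obtain m s where s: "s \<ge> 0" and [measurable]: "Z \<in> borel_measurable M"
    and law: "distr M borel Z = (if s = 0 then return borel m else density lborel (normal_density m s))"
    using Z by (auto simp: gaussian_rv_def)
  have "integrable (distr M borel Z) (\<lambda>x. x)"
  proof (cases "s = 0")
    case True
    interpret R: prob_space "return borel m" by (rule prob_space_return) simp
    have "integrable (return borel m) (\<lambda>x. x)"
      by (rule R.integrable_const_bound[where B = "\<bar>m\<bar>"]) (auto simp: AE_return)
    then show ?thesis using True law by simp
  next
    case False
    then show ?thesis
      using s integrable_normal_moment_nz_1[of s m] by (simp add: law integrable_density)
  qed
  then show ?thesis by (subst (asm) integrable_distr_eq) auto
qed

lemma char_centered_gaussian_rv:
  assumes "prob_space M" and Z: "gaussian_rv M Z" and mean: "prob_space.expectation M Z = 0"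
  obtains v where "\<And>s. char (distr M borel Z) s = of_real (exp (- (v * s)\<^sup>2 / 2))"
proof -
  interpret prob_space M by fact
  obtain m s where s: "s \<ge> 0" and [measurable]: "Z \<in> borel_measurable M"
    and law: "distr M borel Z = (if s = 0 then return borel m else density lborel (normal_density m s))"
    using Z by (auto simp: gaussian_rv_def)
  show ?thesis
  proof (cases "s = 0")
    case True
    have "0 = (\<integral>x. x \<partial>distr M borel Z)" using mean by (simp add: integral_distr)
    also have "\<dots> = m" using True law by (simp add: integral_return)
    finally have "m = 0" by simp
    then have "char (distr M borel Z) t = 1" for t
      using True law by (simp add: char_def integral_return)
    then show ?thesis using that[of 0] by simp
  next
    case False
    then have s0: "s > 0" using s by simp
    have "distr M lborel Z = distr M borel Z" by (rule distr_cong) auto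
    then have D: "distributed M lborel Z (normal_density m s)"
      using False law by (simp add: distributed_def)
    have "m = 0" using normal_distributed_expectation[OF s0 D] mean by simp
    then have "distributed M lborel (\<lambda>\<omega>. Z \<omega> / s) std_normal_density"
      using D normal_standard_normal_convert[OF s0, of Z m] by simp
    then have std: "distr M borel (\<lambda>\<omega>. Z \<omega> / s) = std_normal_distribution"
      by (simp add: distributed_def cong: distr_cong)
    have "char (distr M borel Z) t = char (distr M borel (\<lambda>\<omega>. Z \<omega> / s)) (s * t)" for t
      using s0 by (simp add: char_def integral_distr)
    then show ?thesis using that[of s] by (simp add: std char_std_normal_distribution)
  qed
qed

lemma char_linear_combination:
  assumes G: "gaussian_process M \<eta>" and mean: "mean_zero M \<eta>" and F: "finite F" "F \<subseteq> {0..1}"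
  obtains v where "\<And>s. char (distr M borel (\<lambda>\<omega>. \<Sum>t\<in>F. c t * \<eta> t \<omega>)) s = of_real (exp (- (v * s)\<^sup>2 / 2))"
proof -
  have M: "prob_space M" using G by (simp add: gaussian_process_def)
  interpret prob_space M by fact
  have comb: "gaussian_rv M (\<lambda>\<omega>. \<Sum>t\<in>F. c t * \<eta> t \<omega>)" if "finite F" "F \<subseteq> {0..1}" for F c
    using G that by (simp add: gaussian_process_def)
  have int: "integrable M (\<eta> t)" if "t \<in> F" for t
    using gaussian_rv_integrable[OF M comb[of "{t}" "\<lambda>_. 1"]] that F by auto
  have "expectation (\<lambda>\<omega>. \<Sum>t\<in>F. c t * \<eta> t \<omega>) = (\<Sum>t\<in>F. c t * expectation (\<eta> t))"
    using int by (subst Bochner_Integration.integral_sum) auto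
  also have "\<dots> = 0"
    using mean F(2) by (auto simp: mean_zero_def intro!: sum.neutral)
  finally show ?thesis
    using char_centered_gaussian_rv[OF M comb[OF F]] that by blast
qed

text \<open>Rotation invariance of centered Gaussian laws: a linear functional of the path has characteristic
function \<open>exp (- (v * s)\<^sup>2 / 2)\<close>, and the product of these over the copies, at \<open>s = a i\<close>, depends on \<open>a\<close> only
through the sum of the squares \<open>(a i)\<^sup>2\<close>.\<close>

lemma law_of_unit_combination_of_copies:
  assumes G: "gaussian_process M \<eta>" and mean: "mean_zero M \<eta>"
    and X: "independent_copies N k X M \<eta>" and a: "(\<Sum>i=1..k. (a i)\<^sup>2) = 1"
  shows "distr N path_space (sample_path (\<lambda>t \<omega>. \<Sum>i=1..k. a i * X i t \<omega>)) = distr M path_space (sample_path \<eta>)"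
proof (rule path_law_unique_of_linear_combinations)
  show M: "prob_space M" and \<eta>: "\<And>t. t \<in> {0..1} \<Longrightarrow> \<eta> t \<in> borel_measurable M"
    using G by (simp_all add: gaussian_process_def)
  show N: "prob_space N" using X by (simp add: independent_copies_def)
  interpret M: prob_space M by fact
  interpret N: prob_space N by fact
  have X_meas: "\<And>i t. i \<in> {1..k} \<Longrightarrow> t \<in> {0..1} \<Longrightarrow> X i t \<in> borel_measurable N"
    and X_law: "\<And>i. i \<in> {1..k} \<Longrightarrow> distr N path_space (sample_path (X i)) = distr M path_space (sample_path \<eta>)"
    and indep: "N.indep_vars (\<lambda>_. path_space) (\<lambda>i. sample_path (X i)) {1..k}"
    using X by (auto simp: independent_copies_def)
  show "(\<lambda>\<omega>. \<Sum>i=1..k. a i * X i t \<omega>) \<in> borel_measurable N" if "t \<in> {0..1}" for t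
    using X_meas that by (intro borel_measurable_sum borel_measurable_times) auto
  fix J :: "real set" and c :: "real \<Rightarrow> real"
  assume J: "finite J" "J \<subseteq> {0..1}"
  define L where "L p = (\<Sum>t\<in>J. c t * p t)" for p :: "real \<Rightarrow> real"
  have [measurable]: "L \<in> borel_measurable path_space"
    unfolding L_def[abs_def] using J(2)
    by (intro borel_measurable_sum borel_measurable_times borel_measurable_const measurable_component_singleton) auto
  have L_path: "L (sample_path \<zeta> \<omega>) = (\<Sum>t\<in>J. c t * \<zeta> t \<omega>)" for \<zeta> :: "real \<Rightarrow> 'c \<Rightarrow> real" and \<omega>
    unfolding L_def using J(2) by (intro sum.cong) (auto simp: sample_path_def)
  obtain v where v: "\<And>s. char (distr M borel (\<lambda>\<omega>. \<Sum>t\<in>J. c t * \<eta> t \<omega>)) s = of_real (exp (- (v * s)\<^sup>2 / 2))"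
    using char_linear_combination[OF G mean J] by blast
  have \<eta>_path: "sample_path \<eta> \<in> measurable M path_space" by (rule sample_path_measurable[OF \<eta>])
  have X_path: "sample_path (X i) \<in> measurable N path_space" if "i \<in> {1..k}" for i
    by (rule sample_path_measurable[OF X_meas[OF that]])
  have char_X: "char (distr N borel (\<lambda>\<omega>. a i * L (sample_path (X i) \<omega>))) 1 = of_real (exp (- (v * a i)\<^sup>2 / 2))"
    if i: "i \<in> {1..k}" for i
  proof -
    note [measurable] = X_path[OF i] \<eta>_path
    have "distr N borel (\<lambda>\<omega>. L (sample_path (X i) \<omega>)) = distr (distr N path_space (sample_path (X i))) borel L"
      by (simp add: distr_distr comp_def)
    also have "\<dots> = distr M borel (\<lambda>\<omega>. L (sample_path \<eta> \<omega>))"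
      by (simp add: X_law[OF i] distr_distr comp_def)
    finally have "char (distr N borel (\<lambda>\<omega>. L (sample_path (X i) \<omega>))) (a i) = of_real (exp (- (v * a i)\<^sup>2 / 2))"
      by (simp only: L_path v)
    then show ?thesis by (simp add: char_def integral_distr)
  qed
  have "N.indep_vars (\<lambda>_. borel) (\<lambda>i \<omega>. a i * L (sample_path (X i) \<omega>)) {1..k}"
    by (rule N.indep_vars_compose2[OF indep, where Y = "\<lambda>i p. a i * L p"]) measurable
  then have "char (distr N borel (\<lambda>\<omega>. \<Sum>i=1..k. a i * L (sample_path (X i) \<omega>))) 1
      = (\<Prod>i=1..k. char (distr N borel (\<lambda>\<omega>. a i * L (sample_path (X i) \<omega>))) 1)"
    by (rule N.char_distr_sum)
  also have "\<dots> = of_real (\<Prod>i=1..k. exp (- (v * a i)\<^sup>2 / 2))"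
    unfolding of_real_prod by (rule prod.cong[OF refl char_X])
  also have "(\<Prod>i=1..k. exp (- (v * a i)\<^sup>2 / 2)) = exp (\<Sum>i=1..k. - (v * a i)\<^sup>2 / 2)"
    by (simp add: exp_sum)
  also have "(\<Sum>i=1..k. - (v * a i)\<^sup>2 / 2) = (- v\<^sup>2 / 2) * (\<Sum>i=1..k. (a i)\<^sup>2)"
    by (simp add: sum_distrib_left power_mult_distrib)
  also have "\<dots> = - (v * 1)\<^sup>2 / 2" unfolding a by simp
  also note v[of 1, symmetric]
  finally have eq: "char (distr N borel (\<lambda>\<omega>. \<Sum>i=1..k. a i * L (sample_path (X i) \<omega>))) 1
      = char (distr M borel (\<lambda>\<omega>. L (sample_path \<eta> \<omega>))) 1"
    by (simp only: L_path)
  have m: "(\<lambda>\<omega>. \<Sum>i=1..k. a i * L (sample_path (X i) \<omega>)) \<in> borel_measurable N"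
    "(\<lambda>\<omega>. L (sample_path \<eta> \<omega>)) \<in> borel_measurable M"
    using X_path \<eta>_path by (auto intro!: borel_measurable_sum borel_measurable_times measurable_compose[of _ _ path_space L])
  have swap: "(\<Sum>t\<in>J. c t * (\<Sum>i=1..k. a i * X i t \<omega>)) = (\<Sum>i=1..k. a i * L (sample_path (X i) \<omega>))" for \<omega>
    unfolding L_path sum_distrib_left by (subst sum.swap) (simp add: mult.left_commute)
  show "(\<integral>\<omega>. iexp (\<Sum>t\<in>J. c t * (\<Sum>i=1..k. a i * X i t \<omega>)) \<partial>N) = (\<integral>\<omega>. iexp (\<Sum>t\<in>J. c t * \<eta> t \<omega>) \<partial>M)"
    using eq m unfolding swap L_path[of \<eta>, symmetric] by (simp add: char_def integral_distr)
qed

theorem theorem1p2: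
  fixes M :: "'a measure" and N :: "'b measure"
    and \<eta> :: "real \<Rightarrow> 'a \<Rightarrow> real" and \<phi> :: "real \<Rightarrow> real"
  assumes "gaussian_process M \<eta>" and "mean_zero M \<eta>" and "continuous_process M \<eta>"
    and "(INF t\<in>{0..1}. covar M \<eta> t t) > 0"
    and "((\<lambda>x. sigma2_sup M \<eta> x * ereal (ln (1 / x))) \<longlongrightarrow> 0) (at_right 0)"
    and "\<forall>x\<in>{0..1}. \<phi> x > 0"
    and "\<forall>\<Delta>. nondegenerate_subinterval \<Delta> \<longrightarrow>
           (AE \<omega> in M. (increment_sup \<phi> \<Delta> (\<lambda>t. \<eta> t \<omega>) \<longlongrightarrow> 1) (at_right 0))"
  shows "\<forall>\<Delta> k X. nondegenerate_subinterval \<Delta> \<and> k \<ge> 1 \<and> independent_copies N k X M \<eta> \<longrightarrow>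
           (AE \<omega> in N. (increment_sup \<phi> \<Delta> (\<lambda>t. chi_square k X t \<omega>)
              \<longlongrightarrow> 2 * (SUP u\<in>\<Delta>. ereal (sqrt (chi_square k X u \<omega>)))) (at_right 0))"
proof (intro allI impI, elim conjE)
  fix \<Delta> k and X :: "nat \<Rightarrow> real \<Rightarrow> 'b \<Rightarrow> real"
  assume \<Delta>: "nondegenerate_subinterval \<Delta>" and X: "independent_copies N k X M \<eta>"
  have M: "prob_space M" and \<eta>: "\<And>t. t \<in> {0..1} \<Longrightarrow> \<eta> t \<in> borel_measurable M"
    using assms(1) by (simp_all add: gaussian_process_def)
  have N: "prob_space N" and X_meas: "\<And>i t. i \<in> {1..k} \<Longrightarrow> t \<in> {0..1} \<Longrightarrow> X i t \<in> borel_measurable N"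
    and X_cont: "\<And>i. i \<in> {1..k} \<Longrightarrow> continuous_process N (X i)"
    using X by (auto simp: independent_copies_def)
  obtain D where D: "countable D" "\<And>a. a \<in> D \<Longrightarrow> L2_set a {1..k} = 1"
    and net: "\<And>\<epsilon>. \<epsilon> > 0 \<Longrightarrow> \<exists>A\<subseteq>D. finite A \<and> direction_net {1..k} \<epsilon> A"
    using countable_directions[of "{1..k}"] by auto
  have cont: "AE \<omega> in N. \<forall>i\<in>{1..k}. continuous_on {0..1} (\<lambda>t. X i t \<omega>)"
    using X_cont by (intro AE_ball_countable') (auto simp: continuous_process_def)
  have dir: "AE \<omega> in N. (increment_sup \<phi> I (\<lambda>t. \<Sum>i=1..k. a i * X i t \<omega>) \<longlongrightarrow> 1) (at_right 0)"
    if a: "a \<in> D" and I: "nondegenerate_subinterval I" for a I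
  proof (rule AE_increment_sup_tendsto_transfer[OF M N \<eta> _ assms(3)])
    have "(\<Sum>i=1..k. (a i)\<^sup>2) = 1" using D(2)[OF a] by (simp add: L2_set_def)
    then show "distr N path_space (sample_path (\<lambda>t \<omega>. \<Sum>i=1..k. a i * X i t \<omega>)) = distr M path_space (sample_path \<eta>)"
      by (rule law_of_unit_combination_of_copies[OF assms(1,2) X])
    show "continuous_process N (\<lambda>t \<omega>. \<Sum>i=1..k. a i * X i t \<omega>)"
      unfolding continuous_process_def using cont by eventually_elim (intro continuous_intros, auto)
    show "(\<lambda>\<omega>. \<Sum>i=1..k. a i * X i t \<omega>) \<in> borel_measurable N" if "t \<in> {0..1}" for t
      using X_meas that by (intro borel_measurable_sum borel_measurable_times) auto
    show "I \<subseteq> {0..1}" using I by (simp add: nondegenerate_subinterval_def)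
    show "AE \<omega> in M. (increment_sup \<phi> I (\<lambda>t. \<eta> t \<omega>) \<longlongrightarrow> 1) (at_right 0)"
      using assms(7) I by blast
  qed
  define \<I> where "\<I> = {{p..q} | p q. p \<in> \<rat> \<and> q \<in> \<rat> \<and> p < q \<and> {p..q} \<subseteq> \<Delta>}"
  have "\<I> \<subseteq> (\<lambda>(p, q). {p..q}) ` (\<rat> \<times> \<rat>)" by (auto simp: \<I>_def)
  then have "countable \<I>" by (rule countable_subset) (auto intro: countable_rat)
  have I_nondeg: "nondegenerate_subinterval I" if "I \<in> \<I>" for I
    using that \<Delta> by (auto simp: \<I>_def nondegenerate_subinterval_def is_interval_cc)
  have "AE \<omega> in N. \<forall>I\<in>insert \<Delta> \<I>. \<forall>a\<in>D.
      (increment_sup \<phi> I (\<lambda>t. \<Sum>i=1..k. a i * X i t \<omega>) \<longlongrightarrow> 1) (at_right 0)"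
    using \<open>countable \<I>\<close> D(1) dir I_nondeg \<Delta> by (intro AE_ball_countable') auto
  from this cont show "AE \<omega> in N. (increment_sup \<phi> \<Delta> (\<lambda>t. chi_square k X t \<omega>)
      \<longlongrightarrow> 2 * (SUP u\<in>\<Delta>. ereal (sqrt (chi_square k X u \<omega>)))) (at_right 0)"
  proof eventually_elim
    case (elim \<omega>)
    show ?case
      unfolding chi_square_def L2_set_def[symmetric]
    proof (rule squared_norm_increment_sup_tendsto[OF _ \<Delta> _ net])
      show "(increment_sup \<phi> \<Delta> (\<lambda>t. \<Sum>i=1..k. a i * X i t \<omega>) \<longlongrightarrow> 1) (at_right 0)" if "a \<in> D" for a
        using elim(1) that by blast
      show "(increment_sup \<phi> {p..q} (\<lambda>t. \<Sum>i=1..k. a i * X i t \<omega>) \<longlongrightarrow> 1) (at_right 0)"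
        if "a \<in> D" "p \<in> \<rat>" "q \<in> \<rat>" "p < q" "{p..q} \<subseteq> \<Delta>" for a p q
        using elim(1) that unfolding \<I>_def by blast
    qed (use elim(2) assms(6) in auto)
  qed
qed

end
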